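(* Let $K$ be a unital associative commutative ring, let $C=\{C^n\}_{n\in\mathbb{N}}$ be a linear pre-operad with coefficients in $K$, and let $\mu\in C^2$ satisfy $\mu^2:=\mu\bullet\mu=0$. Then the operator $\delta=\delta_\mu$ satisfies $\delta^2=0$, so the cohomology $H(C)=\{H^n(C)\}_{n\in\mathbb{N}}$, $$H^n(C):=\operatorname{Ker}(C^n\xrightarrow{\delta}C^{n+1})/\operatorname{Im}(C^{n-1}\xrightarrow{\delta}C^n)$$ (with $\operatorname{Im}(C^{-1}\xrightarrow{\delta}C^0):=0$), is defined. The operations $\smile$ and $[\cdot,\cdot]$ on $C$ induce well-defined operations (denoted by the same symbols) $$\smile\colon H^m(C)\otimes_K H^n(C)\to H^{m+n}(C),\qquad [\cdot,\cdot]\colon H^m(C)\otimes_K H^n(C)\to H^{m+n-1}(C),$$ and the triple $\{H(C),\smile,[\cdot,\cdot]\}$ is a Gerstenhaber algebra. That is, for all homogeneous $f,g,h\in H(C)$ of degrees $m,n,p$ respectively (with $|f|=m-1$, $|g|=n-1$, $|h|=p-1$), the following hold: (G1) $[f,g]=-(-1)^{|f||g|}[g,f]$; (G2) $(-1)^{|f||h|}[[f,g],h]+(-1)^{|g||f|}[[g,h],f]+(-1)^{|h||g|}[[h,f],g]=0$; (G3) $(f\smile g)\smile h=f\smile(g\smile h)$; (G4) $f\smile g=(-1)^{mn}\,g\smile f$; (G5) $[h,f\smile g]=[h,f]\smile g+(-1)^{|h|m}f\smile[h,g]$; (G6) with respect to the reduced degree, $[\cdot,\cdot]$ has degree $0$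 and $\smile$ has degree $1$ (so $0=|[\cdot,\cdot]|\neq|\smile|=1$).
   Context: Here $\mathbb{N}$ contains $0$ and $\otimes=\otimes_K$. For a homogeneous element $f\in C^m$, $m$ is its degree and $|f|:=m-1$ its reduced degree. Components $C^n$ with $n<0$ are taken to be $0$, and empty sums are $0$. A linear pre-operad with coefficients in $K$ is a sequence $C=\{C^n\}_{n\in\mathbb{N}}$ of unital $K$-modules such that: (1) For $0\le i\le m-1$ there are $K$-linear partial compositions $\circ_i\in\operatorname{Hom}(C^m\otimes C^n,C^{m+n-1})$. (2) For all $h\in C^p$, $f\in C^m$, $g\in C^n$ (and all indices for which the compositions are defined), $$(h\circ_i f)\circ_j g=\begin{cases}(-1)^{|f||g|}(h\circ_j g)\circ_{i+|g|}f & \text{if } 0\le j\le i-1,\\ h\circ_i(f\circ_{j-i}g) & \text{if } i\le j\le i+|f|,\\ (-1)^{|f||g|}(h\circ_{j-|f|}g)\circ_i f & \text{if } i+m\le j\le |h|+|f|.\end{cases}$$ (3) There is a unit $\mathrm{I}\in C^1$ with $\mathrm{I}\circ_0 f=f=f\circ_i \mathrm{I}$ for $0\le i\le|f|$. Fix $\mu\in C^2$. For $f\in C^m$, $g\in C^n$ define: - cup-multiplication: $f\smile g:=(-1)^m(\mu\circ_0 f)\circ_m g\in C^{m+n}$; - total composition: $f\bullet g:=\sum_{i=0}^{|f|}f\circ_i g\in C^{m+n-1}$; - commutator: $[f,g]:=f\bullet g-(-1)^{|f||g|}g\bullet f\in C^{m+n-1}$; - pre-coboundary operator $\delta=\delta_\mu\colon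 C^m\to C^{m+1}$: $\delta f:=-[f,\mu]=-f\bullet\mu+(-1)^{|f|}\mu\bullet f$. *)

theory Defs
  imports "HOL-Algebra.Module" "HOL-Algebra.AbelCoset"
begin

text \<open>
  Degrees are integers, so that expressions such as \<open>m + n - 1\<close> and the reduced degree
  \<open>m - 1\<close> need no truncated subtraction. Graded modules are nevertheless graded by the natural
  numbers: components of negative degree are required to be zero.
  Since different components may have overlapping carriers, the degrees of the arguments are
  explicit parameters of every operation.
\<close>

section \<open>Modules\<close>

text \<open>\<open>K\<close>-linear maps out of the tensor product of \<open>M\<close> and \<open>N\<close> are rendered as bilinear maps.\<close>

definition bilinear_map ::
  "('k, 'r) ring_scheme \<Rightarrow> ('k, 'a) module \<Rightarrow> ('k, 'b) module \<Rightarrow> ('k, 'c) module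
    \<Rightarrow> ('a \<Rightarrow> 'b \<Rightarrow> 'c) \<Rightarrow> bool" where
  "bilinear_map K M N P \<beta> \<longleftrightarrow>
     (\<forall>x\<in>carrier M. \<forall>y\<in>carrier N. \<beta> x y \<in> carrier P) \<and>
     (\<forall>x\<in>carrier M. \<forall>x'\<in>carrier M. \<forall>y\<in>carrier N.
        \<beta> (x \<oplus>\<^bsub>M\<^esub> x') y = \<beta> x y \<oplus>\<^bsub>P\<^esub> \<beta> x' y) \<and>
     (\<forall>x\<in>carrier M. \<forall>y\<in>carrier N. \<forall>y'\<in>carrier N.
        \<beta> x (y \<oplus>\<^bsub>N\<^esub> y') = \<beta> x y \<oplus>\<^bsub>P\<^esub> \<beta> x y') \<and>
     (\<forall>a\<in>carrier K. \<forall>x\<in>carrier M. \<forall>y\<in>carrier N.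
        \<beta> (a \<odot>\<^bsub>M\<^esub> x) y = a \<odot>\<^bsub>P\<^esub> \<beta> x y \<and> \<beta> x (a \<odot>\<^bsub>N\<^esub> y) = a \<odot>\<^bsub>P\<^esub> \<beta> x y)"

text \<open>\<open>signed M e x\<close> is \<open>(-1)\<^sup>e x\<close>, computed in \<open>M\<close>.\<close>

definition signed :: "('k, 'a) module \<Rightarrow> int \<Rightarrow> 'a \<Rightarrow> 'a" where
  "signed M e x = (if even e then x else \<ominus>\<^bsub>M\<^esub> x)"

text \<open>The ring multiplication and unit that a module record formally carries play no role.\<close>

definition quotient_module :: "('k, 'a) module \<Rightarrow> 'a set \<Rightarrow> ('k, 'a set) module" where
  "quotient_module M N =
     \<lparr>carrier = a_rcosets\<^bsub>M\<^esub> N, mult = undefined, one = undefined,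
      zero = N, add = set_add M,
      smult = (\<lambda>a X. \<Union>x\<in>X. N +>\<^bsub>M\<^esub> (a \<odot>\<^bsub>M\<^esub> x))\<rparr>"

section \<open>Linear pre-operads\<close>

text \<open>\<open>pcomp P m n i f g\<close> is the partial composition of \<open>f\<close> (degree \<open>m\<close>) and \<open>g\<close> (degree \<open>n\<close>)
  at position \<open>i\<close>.\<close>

record ('k, 'c) pre_operad =
  cpt :: "int \<Rightarrow> ('k, 'c) module"
  pcomp :: "int \<Rightarrow> int \<Rightarrow> int \<Rightarrow> 'c \<Rightarrow> 'c \<Rightarrow> 'c"
  op_unit :: 'c

text \<open>In the three associativity relations, \<open>h\<close>, \<open>f\<close>, \<open>g\<close> have degrees \<open>p\<close>, \<open>m\<close>, \<open>n\<close>, and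
  \<open>p - 1\<close>, \<open>m - 1\<close>, \<open>n - 1\<close> are their reduced degrees. The bounds on \<open>i\<close> and \<open>j\<close>
  are exactly those for which all compositions involved are defined.\<close>

locale linear_pre_operad =
  fixes K :: "('k, 'r) ring_scheme" and P :: "('k, 'c) pre_operad"
  assumes cpt_module: "\<And>n. module K (cpt P n)"
    and cpt_negative: "\<And>n. n < 0 \<Longrightarrow> carrier (cpt P n) = {\<zero>\<^bsub>cpt P n\<^esub>}"
    and pcomp_bilinear:
      "\<And>m n i. \<lbrakk>0 \<le> m; 0 \<le> n; 0 \<le> i; i \<le> m - 1\<rbrakk>
        \<Longrightarrow> bilinear_map K (cpt P m) (cpt P n) (cpt P (m + n - 1)) (pcomp P m n i)"
    and pcomp_before:
      "\<And>p m n i j h f g. \<lbrakk>0 \<le> p; 0 \<le> m; 0 \<le> n;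
          h \<in> carrier (cpt P p); f \<in> carrier (cpt P m); g \<in> carrier (cpt P n);
          0 \<le> i; i \<le> p - 1; 0 \<le> j; j \<le> i - 1\<rbrakk>
        \<Longrightarrow> pcomp P (p + m - 1) n j (pcomp P p m i h f) g =
            signed (cpt P (p + m + n - 2)) ((m - 1) * (n - 1))
              (pcomp P (p + n - 1) m (i + (n - 1)) (pcomp P p n j h g) f)"
    and pcomp_nested:
      "\<And>p m n i j h f g. \<lbrakk>0 \<le> p; 0 \<le> m; 0 \<le> n;
          h \<in> carrier (cpt P p); f \<in> carrier (cpt P m); g \<in> carrier (cpt P n);
          0 \<le> i; i \<le> p - 1; i \<le> j; j \<le> i + (m - 1)\<rbrakk>
        \<Longrightarrow> pcomp P (p + m - 1) n j (pcomp P p m i h f) g =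
            pcomp P p (m + n - 1) i h (pcomp P m n (j - i) f g)"
    and pcomp_after:
      "\<And>p m n i j h f g. \<lbrakk>0 \<le> p; 0 \<le> m; 0 \<le> n;
          h \<in> carrier (cpt P p); f \<in> carrier (cpt P m); g \<in> carrier (cpt P n);
          0 \<le> i; i \<le> p - 1; i + m \<le> j; j \<le> (p - 1) + (m - 1)\<rbrakk>
        \<Longrightarrow> pcomp P (p + m - 1) n j (pcomp P p m i h f) g =
            signed (cpt P (p + m + n - 2)) ((m - 1) * (n - 1))
              (pcomp P (p + n - 1) m i (pcomp P p n (j - (m - 1)) h g) f)"
    and unit_closed: "op_unit P \<in> carrier (cpt P 1)"
    and unit_left:
      "\<And>m f. \<lbrakk>0 \<le> m; f \<in> carrier (cpt P m)\<rbrakk> \<Longrightarrow> pcomp P 1 m 0 (op_unit P) f = f"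
    and unit_right:
      "\<And>m i f. \<lbrakk>0 \<le> m; f \<in> carrier (cpt P m); 0 \<le> i; i \<le> m - 1\<rbrakk>
        \<Longrightarrow> pcomp P m 1 i f (op_unit P) = f"

section \<open>Operations on a pre-operad\<close>

text \<open>Partial compositions and the cup-multiplication are given on components of nonnegative
  degree only; on the zero components of negative degree the operations are zero.\<close>

definition cup ::
  "('k, 'c) pre_operad \<Rightarrow> 'c \<Rightarrow> int \<Rightarrow> int \<Rightarrow> 'c \<Rightarrow> 'c \<Rightarrow> 'c" where
  "cup P \<mu> m n f g =
     (if 0 \<le> m \<and> 0 \<le> n
      then signed (cpt P (m + n)) m (pcomp P (m + 1) n m (pcomp P 2 m 0 \<mu> f) g)
      else \<zero>\<^bsub>cpt P (m + n)\<^esub>)"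

definition total_comp ::
  "('k, 'c) pre_operad \<Rightarrow> int \<Rightarrow> int \<Rightarrow> 'c \<Rightarrow> 'c \<Rightarrow> 'c" where
  "total_comp P m n f g =
     (if 0 \<le> m \<and> 0 \<le> n
      then (\<Oplus>\<^bsub>cpt P (m + n - 1)\<^esub> i \<in> {0..m - 1}. pcomp P m n i f g)
      else \<zero>\<^bsub>cpt P (m + n - 1)\<^esub>)"

definition commutator ::
  "('k, 'c) pre_operad \<Rightarrow> int \<Rightarrow> int \<Rightarrow> 'c \<Rightarrow> 'c \<Rightarrow> 'c" where
  "commutator P m n f g =
     total_comp P m n f g \<ominus>\<^bsub>cpt P (m + n - 1)\<^esub>
       signed (cpt P (m + n - 1)) ((m - 1) * (n - 1)) (total_comp P n m g f)"

definition delta :: "('k, 'c) pre_operad \<Rightarrow> 'c \<Rightarrow> int \<Rightarrow> 'c \<Rightarrow> 'c" where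
  "delta P \<mu> m f = \<ominus>\<^bsub>cpt P (m + 1)\<^esub> commutator P m 2 f \<mu>"

section \<open>Cohomology\<close>

definition cocycles :: "('k, 'c) pre_operad \<Rightarrow> 'c \<Rightarrow> int \<Rightarrow> 'c set" where
  "cocycles P \<mu> n = {f \<in> carrier (cpt P n). delta P \<mu> n f = \<zero>\<^bsub>cpt P (n + 1)\<^esub>}"

definition coboundaries :: "('k, 'c) pre_operad \<Rightarrow> 'c \<Rightarrow> int \<Rightarrow> 'c set" where
  "coboundaries P \<mu> n = delta P \<mu> (n - 1) ` carrier (cpt P (n - 1))"

definition cohomology ::
  "('k, 'c) pre_operad \<Rightarrow> 'c \<Rightarrow> int \<Rightarrow> ('k, 'c set) module" where
  "cohomology P \<mu> n =
     quotient_module (cpt P n\<lparr>carrier := cocycles P \<mu> n\<rparr>) (coboundaries P \<mu> n)"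

definition coh_class :: "('k, 'c) pre_operad \<Rightarrow> 'c \<Rightarrow> int \<Rightarrow> 'c \<Rightarrow> 'c set" where
  "coh_class P \<mu> n f = coboundaries P \<mu> n +>\<^bsub>cpt P n\<^esub> f"

text \<open>As for \<^const>\<open>a_r_coset\<close>-based quotients in general, the induced operations are the union
  of the classes of all products of representatives; they are well defined iff this union is a
  single class.\<close>

definition coh_cup ::
  "('k, 'c) pre_operad \<Rightarrow> 'c \<Rightarrow> int \<Rightarrow> int \<Rightarrow> 'c set \<Rightarrow> 'c set \<Rightarrow> 'c set" where
  "coh_cup P \<mu> m n X Y = (\<Union>f\<in>X. \<Union>g\<in>Y. coh_class P \<mu> (m + n) (cup P \<mu> m n f g))"

definition coh_commutator ::
  "('k, 'c) pre_operad \<Rightarrow> 'c \<Rightarrow> int \<Rightarrow> int \<Rightarrow> 'c set \<Rightarrow> 'c set \<Rightarrow> 'c set" where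
  "coh_commutator P \<mu> m n X Y =
     (\<Union>f\<in>X. \<Union>g\<in>Y. coh_class P \<mu> (m + n - 1) (commutator P m n f g))"

section \<open>Gerstenhaber algebras\<close>

definition has_reduced_degree ::
  "(int \<Rightarrow> ('k, 'a) module) \<Rightarrow> (int \<Rightarrow> int \<Rightarrow> 'a \<Rightarrow> 'a \<Rightarrow> 'a) \<Rightarrow> int \<Rightarrow> bool" where
  "has_reduced_degree H \<phi> d \<longleftrightarrow>
     (\<forall>m n k. k - 1 = (m - 1) + (n - 1) + d \<longrightarrow>
        (\<forall>f\<in>carrier (H m). \<forall>g\<in>carrier (H n). \<phi> m n f g \<in> carrier (H k)))"

locale gerstenhaber_algebra =
  fixes K :: "('k, 'r) ring_scheme"
    and H :: "int \<Rightarrow> ('k, 'a) module"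
    and cp :: "int \<Rightarrow> int \<Rightarrow> 'a \<Rightarrow> 'a \<Rightarrow> 'a"
    and br :: "int \<Rightarrow> int \<Rightarrow> 'a \<Rightarrow> 'a \<Rightarrow> 'a"
  assumes H_module: "\<And>n. module K (H n)"
    and H_negative: "\<And>n. n < 0 \<Longrightarrow> carrier (H n) = {\<zero>\<^bsub>H n\<^esub>}"
    and cp_bilinear: "\<And>m n. bilinear_map K (H m) (H n) (H (m + n)) (cp m n)"
    and br_bilinear: "\<And>m n. bilinear_map K (H m) (H n) (H (m + n - 1)) (br m n)"
    and br_antisym:
      "\<And>m n f g. \<lbrakk>f \<in> carrier (H m); g \<in> carrier (H n)\<rbrakk>
        \<Longrightarrow> br m n f g =
            \<ominus>\<^bsub>H (m + n - 1)\<^esub> signed (H (m + n - 1)) ((m - 1) * (n - 1)) (br n m g f)"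
    and br_jacobi:
      "\<And>m n p f g h. \<lbrakk>f \<in> carrier (H m); g \<in> carrier (H n); h \<in> carrier (H p)\<rbrakk>
        \<Longrightarrow> signed (H (m + n + p - 2)) ((m - 1) * (p - 1)) (br (m + n - 1) p (br m n f g) h)
            \<oplus>\<^bsub>H (m + n + p - 2)\<^esub>
            signed (H (m + n + p - 2)) ((n - 1) * (m - 1)) (br (n + p - 1) m (br n p g h) f)
            \<oplus>\<^bsub>H (m + n + p - 2)\<^esub>
            signed (H (m + n + p - 2)) ((p - 1) * (n - 1)) (br (p + m - 1) n (br p m h f) g)
            = \<zero>\<^bsub>H (m + n + p - 2)\<^esub>"
    and cp_assoc:
      "\<And>m n p f g h. \<lbrakk>f \<in> carrier (H m); g \<in> carrier (H n); h \<in> carrier (H p)\<rbrakk>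
        \<Longrightarrow> cp (m + n) p (cp m n f g) h = cp m (n + p) f (cp n p g h)"
    and cp_comm:
      "\<And>m n f g. \<lbrakk>f \<in> carrier (H m); g \<in> carrier (H n)\<rbrakk>
        \<Longrightarrow> cp m n f g = signed (H (m + n)) (m * n) (cp n m g f)"
    and br_leibniz:
      "\<And>m n p f g h. \<lbrakk>f \<in> carrier (H m); g \<in> carrier (H n); h \<in> carrier (H p)\<rbrakk>
        \<Longrightarrow> br p (m + n) h (cp m n f g) =
            cp (p + m - 1) n (br p m h f) g
            \<oplus>\<^bsub>H (m + n + p - 1)\<^esub>
            signed (H (m + n + p - 1)) ((p - 1) * m) (cp m (p + n - 1) f (br p n h g))"
    and br_degree: "has_reduced_degree H br 0"
    and cp_degree: "has_reduced_degree H cp 1"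

end

theory Submission
  imports Defs
begin

text \<open>
  Write \<open>|f| = m - 1\<close> for \<open>f\<close> of degree \<open>m\<close>. Everything comes from one calculus. For cochains
  \<open>h, f, g\<close> let \<open>h\<langle>f, g\<rangle>\<close> be the sum of all \<open>(h \<circ>\<^sub>j g) \<circ>\<^sub>i f\<close> with \<open>i < j\<close>: both \<open>f\<close> and \<open>g\<close> are
  inserted into \<open>h\<close>, with \<open>f\<close> to the left of \<open>g\<close>. If one more cochain is inserted into a composite
  in all possible ways, it lands inside one of the inserted cochains (the nested axiom) or beside
  them (the two exchange axioms). Sorting the terms of a sum by where the last insertion lands
  gives three identities:

  \<^item> \<open>tot_tot\<close>: the associator of the total composition is
    \<open>(h \<bullet> f) \<bullet> g - h \<bullet> (f \<bullet> g) = h\<langle>g, f\<rangle> + (-1)\<^bsup>|f||g|\<^esup> h\<langle>f, g\<rangle>\<close>, hence graded symmetric in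
    \<open>f, g\<close>;
  \<^item> \<open>tot_brace\<close>, which expands \<open>h\<langle>f, g\<rangle> \<bullet> k\<close>;
  \<^item> \<open>brace_tot\<close>, which expands \<open>(h \<bullet> k)\<langle>f, g\<rangle>\<close>.

  Symmetry of the associator is the graded pre-Lie property, and the Jacobi identity
  \<open>bracket_jacobi\<close> is its antisymmetrization. The cup product is, up to sign, \<open>\<mu>\<langle>f, g\<rangle>\<close>, and
  \<open>\<delta>\<close> is bracketing with \<open>\<mu>\<close>. Inserting \<open>\<mu>\<close> for one of the arguments and using \<open>\<mu> \<bullet> \<mu> = 0\<close>
  therefore turns the three identities into \<open>d_d\<close> (\<open>\<delta>\<^sup>2 = 0\<close>), into the derivation rules
  \<open>d_bracket\<close> and \<open>d_cup\<close>, which make both products descend to cohomology, and into two homotopy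
  formulas: \<open>d_tot\<close> shows that \<open>\<delta>(f \<bullet> g)\<close> measures the failure of the cup product to be graded
  commutative, and \<open>d_brace\<close> that \<open>\<delta>(h\<langle>f, g\<rangle>)\<close> measures the failure of the Leibniz rule. Jacobi,
  antisymmetry and associativity of the cup product already hold for cochains.

  These identities are sums with many terms, so they are proved in a type of class
  \<^class>\<open>ab_group_add\<close> rather than in the components, which are modules on carrier sets. A single
  such type serves all pre-operads: the product of all abelian groups whose elements have the
  given type (\<open>ambient\<close>). Each component embeds into it as one factor. Partial compositions are
  transported with their degrees as explicit arguments and act through the projections to the
  factors, so that in the ambient group they are biadditive and satisfy the axioms for all
  elements, without any membership conditions.
\<close>

section \<open>Signs and sums over integer intervals\<close>

definition sg :: "int \<Rightarrow> 'a::ab_group_add \<Rightarrow> 'a" where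
  "sg e x = (if even e then x else - x)"

lemma sg_simps [simp]:
  "sg e 0 = 0" "sg e (x + y) = sg e x + sg e y" "sg e (x - y) = sg e x - sg e y"
  "sg e (- x) = - sg e x" "sg e (sg e' x) = sg (e + e') x"
  by (auto simp: sg_def)

lemma sg_sum: "sg e (\<Sum>i\<in>A. f i) = (\<Sum>i\<in>A. sg e (f i))"
  by (simp add: sg_def sum_negf)

text \<open>
  Both sides sum over the pairs \<open>l < i\<close> in the interval.
\<close>

lemma sum_triangle_swap:
  "(\<Sum>l\<in>{a..<b::int}. \<Sum>i\<in>{l+1..<b}. F l i) = (\<Sum>i\<in>{a..<b}. \<Sum>l\<in>{a..<i}. F l i)"
proof -
  have "(\<Sum>l\<in>{a..<b}. \<Sum>i\<in>{l+1..<b}. F l i) = (\<Sum>l\<in>{a..<b}. \<Sum>i\<in>{i \<in> {a..<b}. l < i}. F l i)"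
    by (intro sum.cong refl) auto
  also have "\<dots> = (\<Sum>i\<in>{a..<b}. \<Sum>l\<in>{l \<in> {a..<b}. l < i}. F l i)"
    by (rule sum.swap_restrict) auto
  also have "\<dots> = (\<Sum>i\<in>{a..<b}. \<Sum>l\<in>{a..<i}. F l i)"
    by (intro sum.cong refl) auto
  finally show ?thesis .
qed

lemma sum_int_split3:
  fixes c l d k :: int
  assumes "c \<le> l" "0 \<le> k" "l + k \<le> d"
  shows "(\<Sum>i\<in>{c..<d}. F i) =
     (\<Sum>i\<in>{c..<l}. F i) + (\<Sum>t\<in>{0..<k}. F (l + t)) + (\<Sum>i\<in>{l+1..<d-k+1}. F (i + k - 1))"
proof -
  have "(\<Sum>i\<in>{c..<d}. F i) = (\<Sum>i\<in>{c..<l} \<union> ({l..<l+k} \<union> {l+k..<d}). F i)"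
    using assms by (intro sum.cong) auto
  also have "\<dots> = (\<Sum>i\<in>{c..<l}. F i) + ((\<Sum>i\<in>{l..<l+k}. F i) + (\<Sum>i\<in>{l+k..<d}. F i))"
    using assms by (simp add: sum.union_disjoint Int_Un_distrib)
  also have "(\<Sum>i\<in>{l..<l+k}. F i) = (\<Sum>t\<in>{0..<k}. F (l + t))"
    by (rule sum.reindex_bij_witness[of _ "\<lambda>t. l + t" "\<lambda>i. i - l"]) auto
  also have "(\<Sum>i\<in>{l+k..<d}. F i) = (\<Sum>i\<in>{l+1..<d-k+1}. F (i + k - 1))"
    by (rule sum.reindex_bij_witness[of _ "\<lambda>t. t + k - 1" "\<lambda>i. i - k + 1"]) auto
  finally show ?thesis by (simp add: add.assoc)
qed

section \<open>Compositions and braces\<close>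

text \<open>
  The graded axioms of partial composition, for elements that carry no degree of their own:
  \<open>pc m n i f g\<close> composes \<open>f\<close>, regarded as an element of degree \<open>m\<close>, with \<open>g\<close>, regarded as an
  element of degree \<open>n\<close>. Compositions at positions that do not exist are zero, which frees the
  two exchange axioms from all bounds except the order of the positions and makes them
  equivalent to each other (\<open>pc_after\<close> below).
\<close>

locale graded_compositions =
  fixes pc :: "int \<Rightarrow> int \<Rightarrow> int \<Rightarrow> 'a::ab_group_add \<Rightarrow> 'a \<Rightarrow> 'a"
  assumes pc_add_left: "pc m n i (f + f') g = pc m n i f g + pc m n i f' g"
    and pc_add_right: "pc m n i f (g + g') = pc m n i f g + pc m n i f g'"
    and pc_outside: "\<not> (0 \<le> i \<and> i < m \<and> 0 \<le> n) \<Longrightarrow> pc m n i f g = 0"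
    and pc_before: "j < i \<Longrightarrow> pc (p + m - 1) n j (pc p m i h f) g =
          sg ((m - 1) * (n - 1)) (pc (p + n - 1) m (i + n - 1) (pc p n j h g) f)"
    and pc_nested: "i \<le> j \<Longrightarrow> j < i + m \<Longrightarrow>
          pc (p + m - 1) n j (pc p m i h f) g = pc p (m + n - 1) i h (pc m n (j - i) f g)"
begin

lemma pc_zero [simp]: "pc m n i 0 g = 0" "pc m n i f 0 = 0"
  using pc_add_left[of m n i 0 0 g] pc_add_right[of m n i f 0 0] by simp_all

lemma pc_minus: "pc m n i (- f) g = - pc m n i f g" "pc m n i f (- g) = - pc m n i f g"
  using pc_add_left[of m n i f "- f" g] pc_add_right[of m n i f g "- g"]
  by (simp_all add: eq_neg_iff_add_eq_0 add.commute)

lemma pc_sg: "pc m n i (sg e f) g = sg e (pc m n i f g)" "pc m n i f (sg e g) = sg e (pc m n i f g)"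
  by (simp_all add: sg_def pc_minus)

lemma pc_sum_left: "pc m n i (\<Sum>x\<in>A. f x) g = (\<Sum>x\<in>A. pc m n i (f x) g)"
  by (induction A rule: infinite_finite_induct) (simp_all add: pc_add_left)

lemma pc_sum_right: "pc m n i f (\<Sum>x\<in>A. g x) = (\<Sum>x\<in>A. pc m n i f (g x))"
  by (induction A rule: infinite_finite_induct) (simp_all add: pc_add_right)

definition tot :: "int \<Rightarrow> int \<Rightarrow> 'a \<Rightarrow> 'a \<Rightarrow> 'a" where
  "tot m n f g = (\<Sum>i\<in>{0..<m}. pc m n i f g)"

text \<open>
  The right-hand argument is inserted first. The position of \<open>f\<close> is then unaffected by the degree
  of \<open>g\<close>, and no index has to be shifted; inserting \<open>f\<close> first would change the sum by the sign
  \<open>(-1)\<^bsup>|f||g|\<^esup>\<close>.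
\<close>

definition brace :: "int \<Rightarrow> int \<Rightarrow> int \<Rightarrow> 'a \<Rightarrow> 'a \<Rightarrow> 'a \<Rightarrow> 'a" where
  "brace p m n h f g = (\<Sum>j\<in>{0..<p}. \<Sum>i\<in>{0..<j}. pc (p + n - 1) m i (pc p n j h g) f)"

definition brace3 :: "int \<Rightarrow> int \<Rightarrow> int \<Rightarrow> int \<Rightarrow> 'a \<Rightarrow> 'a \<Rightarrow> 'a \<Rightarrow> 'a \<Rightarrow> 'a" where
  "brace3 p l m n h e f g = (\<Sum>k\<in>{0..<p}. \<Sum>j\<in>{0..<k}. \<Sum>i\<in>{0..<j}.
      pc (p + n + m - 2) l i (pc (p + n - 1) m j (pc p n k h g) f) e)"

lemma pc_after:
  assumes "l < i"
  shows "pc (x + k - 1) m (i + k - 1) (pc x k l X K) f =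
    sg ((k - 1) * (m - 1)) (pc (x + m - 1) k l (pc x m i X f) K)"
  by (simp add: pc_before[OF assms] sg_def mult.commute)

text \<open>
  The basic sorting step: \<open>f\<close> is inserted into \<open>X \<circ>\<^sub>l K\<close> at every position between \<open>c\<close> and \<open>d\<close>. It
  lands before \<open>K\<close>, inside \<open>K\<close>, or after \<open>K\<close>. In the last case the order of the two insertions
  is exchanged, which shifts the position of \<open>f\<close> by \<open>|K|\<close>. The weight \<open>F\<close> allows a summand to depend
  on the position, as needed when the range of a further insertion is bounded by it.
\<close>

lemma weighted_insertion:
  assumes "c \<le> l" "0 \<le> k" "l + k \<le> d"
  shows "(\<Sum>i\<in>{c..<d}. F i (pc (x + k - 1) m i (pc x k l X K) f)) =
     (\<Sum>i\<in>{c..<l}. F i (pc (x + k - 1) m i (pc x k l X K) f)) +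
     (\<Sum>t\<in>{0..<k}. F (l + t) (pc x (k + m - 1) l X (pc k m t K f))) +
     (\<Sum>i\<in>{l+1..<d-k+1}. F (i + k - 1)
        (sg ((k - 1) * (m - 1)) (pc (x + m - 1) k l (pc x m i X f) K)))"
  by (subst sum_int_split3[OF assms]) (simp add: pc_nested pc_after)

lemma insertion:
  assumes "c \<le> l" "0 \<le> k" "l + k \<le> d"
  shows "(\<Sum>i\<in>{c..<d}. pc (x + k - 1) m i (pc x k l X K) f) =
     (\<Sum>i\<in>{c..<l}. pc (x + k - 1) m i (pc x k l X K) f) +
     pc x (k + m - 1) l X (tot k m K f) +
     sg ((k - 1) * (m - 1)) (\<Sum>i\<in>{l+1..<d-k+1}. pc (x + m - 1) k l (pc x m i X f) K)"
  using weighted_insertion[OF assms, of "\<lambda>_ y. y"]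
  by (simp add: sg_sum tot_def pc_sum_right)

lemma tot_neg: "m < 0 \<or> n < 0 \<Longrightarrow> tot m n f g = 0"
  by (auto simp: tot_def pc_outside)

lemma brace_neg: "p < 0 \<or> m < 0 \<or> n < 0 \<Longrightarrow> brace p m n h f g = 0"
  by (auto simp: brace_def pc_outside)

lemma tot_add: "tot m n (f + f') g = tot m n f g + tot m n f' g"
  "tot m n f (g + g') = tot m n f g + tot m n f g'"
  by (simp_all add: tot_def pc_add_left pc_add_right sum.distrib)

lemma tot_zero [simp]: "tot m n 0 g = 0" "tot m n f 0 = 0"
  by (simp_all add: tot_def)

lemma tot_minus: "tot m n (- f) g = - tot m n f g" "tot m n f (- g) = - tot m n f g"
  by (simp_all add: tot_def pc_minus sum_negf)

lemma brace_add:
  "brace p m n (h + h') f g = brace p m n h f g + brace p m n h' f g"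
  "brace p m n h (f + f') g = brace p m n h f g + brace p m n h f' g"
  "brace p m n h f (g + g') = brace p m n h f g + brace p m n h f g'"
  by (simp_all add: brace_def pc_add_left pc_add_right sum.distrib)

lemma brace_minus:
  "brace p m n (- h) f g = - brace p m n h f g"
  "brace p m n h (- f) g = - brace p m n h f g"
  "brace p m n h f (- g) = - brace p m n h f g"
  by (simp_all add: brace_def pc_minus sum_negf)

lemma brace_zero [simp]:
  "brace p m n 0 f g = 0" "brace p m n h 0 g = 0" "brace p m n h f 0 = 0"
  by (simp_all add: brace_def)

text \<open>
  Insertions of \<open>g\<close> before \<open>f\<close> form \<open>h\<langle>g, f\<rangle>\<close>, those inside \<open>f\<close> form \<open>h \<bullet> (f \<bullet> g)\<close>, and those
  after \<open>f\<close> form \<open>h\<langle>f, g\<rangle>\<close> once \<open>f\<close> and \<open>g\<close> have been exchanged.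
\<close>

lemma tot_tot:
  "tot (p + m - 1) n (tot p m h f) g =
     tot p (m + n - 1) h (tot m n f g) + brace p n m h g f +
     sg ((m - 1) * (n - 1)) (brace p m n h f g)"
proof (cases "0 \<le> m")
  case True
  have "tot (p + m - 1) n (tot p m h f) g =
     (\<Sum>l\<in>{0..<p}. \<Sum>i\<in>{0..<p + m - 1}. pc (p + m - 1) n i (pc p m l h f) g)"
    by (simp add: tot_def pc_sum_left sum.swap[of _ "{0..<p}"])
  also have "\<dots> = (\<Sum>l\<in>{0..<p}. (\<Sum>i\<in>{0..<l}. pc (p + m - 1) n i (pc p m l h f) g) +
     pc p (m + n - 1) l h (tot m n f g) +
     sg ((m - 1) * (n - 1)) (\<Sum>i\<in>{l+1..<p}. pc (p + n - 1) m l (pc p n i h g) f))"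
    using True by (intro sum.cong refl) (subst insertion, auto)
  also have "\<dots> = brace p n m h g f + tot p (m + n - 1) h (tot m n f g) +
     sg ((m - 1) * (n - 1)) (brace p m n h f g)"
    by (simp add: sum.distrib brace_def tot_def[of p] sg_sum[symmetric] sum_triangle_swap)
  finally show ?thesis by (simp add: ac_simps)
next
  case False
  then show ?thesis by (simp add: tot_neg brace_neg)
qed

text \<open>
  Read from left to right, \<open>k\<close> can be inserted in five places: before \<open>f\<close>, inside \<open>f\<close>, between
  \<open>f\<close> and \<open>g\<close>, inside \<open>g\<close>, or after \<open>g\<close>. It acquires the sign of each element that it passes.
\<close>

lemma tot_brace:
  assumes "0 \<le> m" "0 \<le> n"
  shows "tot (p + m + n - 2) q (brace p m n h f g) k =
     brace3 p q m n h k f g + brace p (m + q - 1) n h (tot m q f k) g +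
     sg ((m - 1) * (q - 1)) (brace3 p m q n h f k g + brace p m (n + q - 1) h f (tot n q g k)) +
     sg ((m - 1) * (q - 1) + (n - 1) * (q - 1)) (brace3 p m n q h f g k)"
proof -
  have inner: "(\<Sum>l\<in>{0..<p+m+n-2}. pc (p+m+n-2) q l (pc (p+n-1) m i (pc p n j h g) f) k) =
     (\<Sum>l\<in>{0..<i}. pc (p+n+m-2) q l (pc (p+n-1) m i (pc p n j h g) f) k) +
     pc (p + n - 1) (m + q - 1) i (pc p n j h g) (tot m q f k) +
     sg ((m - 1) * (q - 1))
      ((\<Sum>l\<in>{i+1..<j}. pc (p+n+q-2) m i (pc (p+n-1) q l (pc p n j h g) k) f) +
       pc (p + (n + q - 1) - 1) m i (pc p (n + q - 1) j h (tot n q g k)) f +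
       sg ((n - 1) * (q - 1))
        (\<Sum>l\<in>{j+1..<p}. pc (p+n+q-2) m i (pc (p+q-1) n j (pc p q l h k) g) f))"
    if "0 \<le> j" "j < p" "0 \<le> i" "i < j" for i j
  proof -
    have "(\<Sum>l\<in>{0..<p+m+n-2}. pc (p+m+n-2) q l (pc (p+n-1) m i (pc p n j h g) f) k) =
       (\<Sum>l\<in>{0..<p+m+n-2}. pc ((p+n-1)+m-1) q l (pc (p+n-1) m i (pc p n j h g) f) k)"
      by (simp add: algebra_simps)
    also have "\<dots> = (\<Sum>l\<in>{0..<i}. pc ((p+n-1)+m-1) q l (pc (p+n-1) m i (pc p n j h g) f) k) +
       pc (p + n - 1) (m + q - 1) i (pc p n j h g) (tot m q f k) +
       sg ((m - 1) * (q - 1)) (\<Sum>l\<in>{i+1..<p+m+n-2-m+1}.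
         pc ((p+n-1) + q - 1) m i (pc (p+n-1) q l (pc p n j h g) k) f)"
      using that assms by (intro insertion) auto
    also have "p + m + n - 2 - m + 1 = p + n - 1" by simp
    also have "(\<Sum>l\<in>{i+1..<p+n-1}. pc ((p+n-1)+q-1) m i (pc (p+n-1) q l (pc p n j h g) k) f)
      = pc ((p+n-1)+q-1) m i (\<Sum>l\<in>{i+1..<p+n-1}. pc (p+n-1) q l (pc p n j h g) k) f"
      by (simp add: pc_sum_left)
    also have "(\<Sum>l\<in>{i+1..<p+n-1}. pc (p+n-1) q l (pc p n j h g) k) =
       (\<Sum>l\<in>{i+1..<j}. pc (p+n-1) q l (pc p n j h g) k) +
       pc p (n + q - 1) j h (tot n q g k) +
       sg ((n - 1) * (q - 1)) (\<Sum>l\<in>{j+1..<p+n-1-n+1}. pc (p+q-1) n j (pc p q l h k) g)"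
      using that assms by (intro insertion) auto
    finally show ?thesis
      by (simp add: pc_add_left pc_sum_left pc_sg sg_sum algebra_simps)
  qed
  have "tot (p + m + n - 2) q (brace p m n h f g) k =
     (\<Sum>j\<in>{0..<p}. \<Sum>i\<in>{0..<j}. \<Sum>l\<in>{0..<p+m+n-2}.
        pc (p+m+n-2) q l (pc (p+n-1) m i (pc p n j h g) f) k)"
    by (simp add: tot_def brace_def pc_sum_left sum.swap[of _ "{0..<p+m+n-2}"])
  also have "\<dots> = (\<Sum>j\<in>{0..<p}. \<Sum>i\<in>{0..<j}.
     (\<Sum>l\<in>{0..<i}. pc (p+n+m-2) q l (pc (p+n-1) m i (pc p n j h g) f) k) +
     pc (p + n - 1) (m + q - 1) i (pc p n j h g) (tot m q f k) +
     sg ((m - 1) * (q - 1))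
      ((\<Sum>l\<in>{i+1..<j}. pc (p+n+q-2) m i (pc (p+n-1) q l (pc p n j h g) k) f) +
       pc (p + (n + q - 1) - 1) m i (pc p (n + q - 1) j h (tot n q g k)) f +
       sg ((n - 1) * (q - 1))
        (\<Sum>l\<in>{j+1..<p}. pc (p+n+q-2) m i (pc (p+q-1) n j (pc p q l h k) g) f)))"
    by (intro sum.cong refl inner) auto
  also have "\<dots> = brace3 p q m n h k f g + brace p (m + q - 1) n h (tot m q f k) g +
     sg ((m - 1) * (q - 1)) (
       (\<Sum>j\<in>{0..<p}. \<Sum>i\<in>{0..<j}. \<Sum>l\<in>{i+1..<j}.
          pc (p+n+q-2) m i (pc (p+n-1) q l (pc p n j h g) k) f) +
       brace p m (n + q - 1) h f (tot n q g k)) +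
     sg ((m - 1) * (q - 1) + (n - 1) * (q - 1))
       (\<Sum>j\<in>{0..<p}. \<Sum>i\<in>{0..<j}. \<Sum>l\<in>{j+1..<p}.
          pc (p+n+q-2) m i (pc (p+q-1) n j (pc p q l h k) g) f)"
    by (simp add: sum.distrib brace_def brace3_def sg_sum[symmetric] add.assoc)
  also have "(\<Sum>j\<in>{0..<p}. \<Sum>i\<in>{0..<j}. \<Sum>l\<in>{j+1..<p}.
          pc (p+n+q-2) m i (pc (p+q-1) n j (pc p q l h k) g) f) =
     (\<Sum>j\<in>{0..<p}. \<Sum>l\<in>{j+1..<p}. \<Sum>i\<in>{0..<j}.
          pc (p+n+q-2) m i (pc (p+q-1) n j (pc p q l h k) g) f)"
    by (intro sum.cong refl sum.swap)
  also have "(\<Sum>j\<in>{0..<p}. \<Sum>i\<in>{0..<j}. \<Sum>l\<in>{i+1..<j}.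
          pc (p+n+q-2) m i (pc (p+n-1) q l (pc p n j h g) k) f) = brace3 p m q n h f k g"
    by (simp only: sum_triangle_swap brace3_def)
  also have "(\<Sum>j\<in>{0..<p}. \<Sum>l\<in>{j+1..<p}. \<Sum>i\<in>{0..<j}.
          pc (p+n+q-2) m i (pc (p+q-1) n j (pc p q l h k) g) f) = brace3 p m n q h f g k"
    by (simp only: sum_triangle_swap brace3_def) (simp add: ac_simps)
  finally show ?thesis .
qed

text \<open>
  Here \<open>g\<close> and \<open>f\<close>, with \<open>f\<close> to the left, are inserted into \<open>h \<circ>\<^sub>l K\<close>. The term is determined by
  which of them lie before, inside or after \<open>K\<close>; the six possibilities are the six terms.
\<close>

lemma brace_tot:
  assumes "0 \<le> k" "0 \<le> n"
  shows "brace (p + k - 1) m n (tot p k h K) f g =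
     brace3 p m n k h f g K + brace p m (k + n - 1) h f (tot k n K g) +
     tot p (k + m + n - 2) h (brace k m n K f g) +
     sg ((k - 1) * (n - 1)) (brace3 p m k n h f K g + brace p (k + m - 1) n h (tot k m K f) g) +
     sg ((k - 1) * (n - 1) + (k - 1) * (m - 1)) (brace3 p k m n h K f g)"
proof -
  \<comment> \<open>Insertion of \<open>f\<close> to the left of position \<open>j\<close>, where \<open>g\<close> has been inserted. The three facts
    below evaluate it when \<open>g\<close> lies before, inside and after \<open>K\<close>.\<close>
  define F where "F j y = (\<Sum>i\<in>{0..<j}. pc (p + k + n - 2) m i y f)" for j y
  have F_before: "F j (pc (p + k - 1) n j (pc p k l h K) g) =
      (\<Sum>i\<in>{0..<j}. pc (p + k + n - 2) m i (pc (p + k - 1) n j (pc p k l h K) g) f)" for j l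
    by (simp add: F_def)
  have F_nested: "F (l + t) (pc p (k + n - 1) l h (pc k n t K g)) =
      (\<Sum>i\<in>{0..<l}. pc (p + (k + n - 1) - 1) m i (pc p (k + n - 1) l h (pc k n t K g)) f) +
      pc p (k + m + n - 2) l h (\<Sum>s\<in>{0..<t}. pc (k + n - 1) m s (pc k n t K g) f)"
    if "0 \<le> l" "0 \<le> t" "t < k" for l t
  proof -
    have "F (l + t) (pc p (k + n - 1) l h (pc k n t K g)) =
       (\<Sum>i\<in>{0..<l + t}. pc (p + (k + n - 1) - 1) m i (pc p (k + n - 1) l h (pc k n t K g)) f)"
      by (simp add: F_def algebra_simps)
    also have "\<dots> =
       (\<Sum>i\<in>{0..<l}. pc (p + (k + n - 1) - 1) m i (pc p (k + n - 1) l h (pc k n t K g)) f) +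
       (\<Sum>s\<in>{0..<t}. pc (p + (k + n - 1) - 1) m (l + s) (pc p (k + n - 1) l h (pc k n t K g)) f)"
      using sum_int_split3[of 0 l t "l + t"] that by simp
    also have "(\<Sum>s\<in>{0..<t}. pc (p + (k + n - 1) - 1) m (l + s) (pc p (k + n - 1) l h (pc k n t K g)) f)
       = (\<Sum>s\<in>{0..<t}. pc p (k + n - 1 + m - 1) l h (pc (k + n - 1) m s (pc k n t K g) f))"
      using that assms by (intro sum.cong refl) (subst pc_nested, auto)
    finally show ?thesis by (simp add: pc_sum_right algebra_simps)
  qed
  have F_after: "F (j + k - 1) (pc (p + n - 1) k l (pc p n j h g) K) =
      (\<Sum>i\<in>{0..<l}. pc (p + n + k - 2) m i (pc (p + n - 1) k l (pc p n j h g) K) f) +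
      pc (p + n - 1) (k + m - 1) l (pc p n j h g) (tot k m K f) +
      sg ((k - 1) * (m - 1))
        (\<Sum>i\<in>{l+1..<j}. pc (p + n + m - 2) k l (pc (p + n - 1) m i (pc p n j h g) f) K)"
    if "0 \<le> l" "l < j" for l j
  proof -
    have "F (j + k - 1) (pc (p + n - 1) k l (pc p n j h g) K) =
      (\<Sum>i\<in>{0..<j + k - 1}. pc ((p + n - 1) + k - 1) m i (pc (p + n - 1) k l (pc p n j h g) K) f)"
      by (simp add: F_def algebra_simps)
    also have "\<dots> =
      (\<Sum>i\<in>{0..<l}. pc ((p + n - 1) + k - 1) m i (pc (p + n - 1) k l (pc p n j h g) K) f) +
      pc (p + n - 1) (k + m - 1) l (pc p n j h g) (tot k m K f) +
      sg ((k - 1) * (m - 1)) (\<Sum>i\<in>{l+1..<j + k - 1 - k + 1}.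
         pc ((p + n - 1) + m - 1) k l (pc (p + n - 1) m i (pc p n j h g) f) K)"
      using that assms by (intro insertion) auto
    finally show ?thesis by (simp add: algebra_simps)
  qed
  have F_sg: "F j (sg e y) = sg e (F j y)" for j e y
    by (simp add: F_def pc_sg sg_sum)
  have "brace (p + k - 1) m n (tot p k h K) f g =
     (\<Sum>l\<in>{0..<p}. \<Sum>j\<in>{0..<p + k - 1}. F j (pc (p + k - 1) n j (pc p k l h K) g))"
    by (simp add: brace_def tot_def F_def pc_sum_left sum.swap[of _ "{0..<p}"] algebra_simps)
  also have "\<dots> = (\<Sum>l\<in>{0..<p}.
      (\<Sum>j\<in>{0..<l}. F j (pc (p + k - 1) n j (pc p k l h K) g)) +
      (\<Sum>t\<in>{0..<k}. F (l + t) (pc p (k + n - 1) l h (pc k n t K g))) +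
      (\<Sum>j\<in>{l+1..<p}. sg ((k - 1) * (n - 1))
         (F (j + k - 1) (pc (p + n - 1) k l (pc p n j h g) K))))"
    using assms by (intro sum.cong refl) (subst weighted_insertion, auto simp: F_sg)
  also have "\<dots> =
      (\<Sum>l\<in>{0..<p}. \<Sum>j\<in>{0..<l}. F j (pc (p + k - 1) n j (pc p k l h K) g)) +
      (\<Sum>l\<in>{0..<p}. \<Sum>t\<in>{0..<k}. F (l + t) (pc p (k + n - 1) l h (pc k n t K g))) +
      sg ((k - 1) * (n - 1)) (\<Sum>l\<in>{0..<p}. \<Sum>j\<in>{l+1..<p}.
         F (j + k - 1) (pc (p + n - 1) k l (pc p n j h g) K))"
    by (simp add: sum.distrib sg_sum)
  also have "(\<Sum>l\<in>{0..<p}. \<Sum>j\<in>{0..<l}. F j (pc (p + k - 1) n j (pc p k l h K) g)) =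
      brace3 p m n k h f g K"
    by (simp add: brace3_def F_def)
  also have "(\<Sum>l\<in>{0..<p}. \<Sum>t\<in>{0..<k}. F (l + t) (pc p (k + n - 1) l h (pc k n t K g))) =
      (\<Sum>l\<in>{0..<p}. \<Sum>t\<in>{0..<k}.
        (\<Sum>i\<in>{0..<l}. pc (p + (k + n - 1) - 1) m i (pc p (k + n - 1) l h (pc k n t K g)) f) +
        pc p (k + m + n - 2) l h (\<Sum>s\<in>{0..<t}. pc (k + n - 1) m s (pc k n t K g) f))"
    by (intro sum.cong refl F_nested) auto
  also have "\<dots> = (\<Sum>l\<in>{0..<p}. \<Sum>t\<in>{0..<k}. \<Sum>i\<in>{0..<l}.
          pc (p + (k + n - 1) - 1) m i (pc p (k + n - 1) l h (pc k n t K g)) f) +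
        tot p (k + m + n - 2) h (brace k m n K f g)"
    by (simp add: sum.distrib tot_def brace_def pc_sum_right)
  also have "(\<Sum>l\<in>{0..<p}. \<Sum>t\<in>{0..<k}. \<Sum>i\<in>{0..<l}.
          pc (p + (k + n - 1) - 1) m i (pc p (k + n - 1) l h (pc k n t K g)) f) =
      (\<Sum>l\<in>{0..<p}. \<Sum>i\<in>{0..<l}. \<Sum>t\<in>{0..<k}.
          pc (p + (k + n - 1) - 1) m i (pc p (k + n - 1) l h (pc k n t K g)) f)"
    by (intro sum.cong refl sum.swap)
  also have "\<dots> = brace p m (k + n - 1) h f (tot k n K g)"
    by (simp add: brace_def tot_def pc_sum_left pc_sum_right)
  also have "(\<Sum>l\<in>{0..<p}. \<Sum>j\<in>{l+1..<p}. F (j + k - 1) (pc (p + n - 1) k l (pc p n j h g) K))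
      = (\<Sum>j\<in>{0..<p}. \<Sum>l\<in>{0..<j}. F (j + k - 1) (pc (p + n - 1) k l (pc p n j h g) K))"
    by (rule sum_triangle_swap)
  also have "\<dots> = (\<Sum>j\<in>{0..<p}. \<Sum>l\<in>{0..<j}.
      (\<Sum>i\<in>{0..<l}. pc (p + n + k - 2) m i (pc (p + n - 1) k l (pc p n j h g) K) f) +
      pc (p + n - 1) (k + m - 1) l (pc p n j h g) (tot k m K f) +
      sg ((k - 1) * (m - 1))
        (\<Sum>i\<in>{l+1..<j}. pc (p + n + m - 2) k l (pc (p + n - 1) m i (pc p n j h g) f) K))"
    by (intro sum.cong refl F_after) auto
  also have "\<dots> = brace3 p m k n h f K g + brace p (k + m - 1) n h (tot k m K f) g +
      sg ((k - 1) * (m - 1)) (\<Sum>j\<in>{0..<p}. \<Sum>l\<in>{0..<j}. \<Sum>i\<in>{l+1..<j}.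
         pc (p + n + m - 2) k l (pc (p + n - 1) m i (pc p n j h g) f) K)"
    by (simp add: sum.distrib brace_def brace3_def sg_sum)
  also have "(\<Sum>j\<in>{0..<p}. \<Sum>l\<in>{0..<j}. \<Sum>i\<in>{l+1..<j}.
         pc (p + n + m - 2) k l (pc (p + n - 1) m i (pc p n j h g) f) K) = brace3 p k m n h K f g"
    by (simp only: sum_triangle_swap brace3_def)
  finally show ?thesis by (simp add: algebra_simps)
qed

lemma tot_sg: "tot m n (sg e f) g = sg e (tot m n f g)" "tot m n f (sg e g) = sg e (tot m n f g)"
  by (simp_all add: sg_def tot_minus)

lemma brace_sg:
  "brace p m n (sg e h) f g = sg e (brace p m n h f g)"
  "brace p m n h (sg e f) g = sg e (brace p m n h f g)"
  "brace p m n h f (sg e g) = sg e (brace p m n h f g)"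
  by (simp_all add: sg_def brace_minus)

lemma tot_diff: "tot m n (f - f') g = tot m n f g - tot m n f' g"
  "tot m n f (g - g') = tot m n f g - tot m n f g'"
  using tot_add(1)[of m n f "- f'" g] tot_add(2)[of m n f g "- g'"] by (simp_all add: tot_minus)

lemma brace_diff:
  "brace p m n (h - h') f g = brace p m n h f g - brace p m n h' f g"
  "brace p m n h (f - f') g = brace p m n h f g - brace p m n h f' g"
  "brace p m n h f (g - g') = brace p m n h f g - brace p m n h f g'"
  using brace_add(1)[of p m n h "- h'" f g] brace_add(2)[of p m n h f "- f'" g]
    brace_add(3)[of p m n h f g "- g'"] by (simp_all add: brace_minus)

definition bracket :: "int \<Rightarrow> int \<Rightarrow> 'a \<Rightarrow> 'a \<Rightarrow> 'a" where
  "bracket m n f g = tot m n f g - sg ((m - 1) * (n - 1)) (tot n m g f)"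

lemma bracket_zero: "bracket m n 0 g = 0" "bracket m n f 0 = 0"
  by (simp_all add: bracket_def)

lemma bracket_minus: "bracket m n (- f) g = - bracket m n f g"
  "bracket m n f (- g) = - bracket m n f g"
  by (simp_all add: bracket_def tot_minus)

lemma bracket_antisym: "bracket m n f g = - sg ((m - 1) * (n - 1)) (bracket n m g f)"
  by (simp add: bracket_def sg_def mult.commute)

text \<open>
  The braces on the right of \<open>tot_tot\<close> are exchanged, up to the sign, when \<open>f\<close> and \<open>g\<close> are.
\<close>

lemma tot_tot_symmetric:
  "tot (p + m - 1) n (tot p m h f) g - tot p (m + n - 1) h (tot m n f g) =
   sg ((m - 1) * (n - 1)) (tot (p + n - 1) m (tot p n h g) f - tot p (m + n - 1) h (tot n m g f))"
  using tot_tot[of p m n h f g] tot_tot[of p n m h g f]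
  by (cases "even m"; cases "even n") (simp_all add: sg_def add_ac)

text \<open>
  Expanding the commutators gives the twelve terms of six associators, one for each order of
  \<open>f, g, h\<close>; they cancel in pairs that differ by exchanging the last two arguments.
\<close>

lemma bracket_jacobi:
  "sg ((m - 1) * (p - 1)) (bracket (m + n - 1) p (bracket m n f g) h) +
   sg ((n - 1) * (m - 1)) (bracket (n + p - 1) m (bracket n p g h) f) +
   sg ((p - 1) * (n - 1)) (bracket (p + m - 1) n (bracket p m h f) g) = 0"
proof -
  note fgh = tot_tot_symmetric[of m n p f g h]
  note ghf = tot_tot_symmetric[of n p m g h f]
  note hfg = tot_tot_symmetric[of p m n h f g]
  have eqs:
    "tot (m + n - 1) p (tot m n f g) h = tot m (n + p - 1) f (tot n p g h) +
       sg ((n - 1) * (p - 1)) (tot (m + p - 1) n (tot m p f h) g - tot m (n + p - 1) f (tot p n h g))"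
    "tot (n + p - 1) m (tot n p g h) f = tot n (m + p - 1) g (tot p m h f) +
       sg ((p - 1) * (m - 1)) (tot (m + n - 1) p (tot n m g f) h - tot n (m + p - 1) g (tot m p f h))"
    "tot (m + p - 1) n (tot p m h f) g = tot p (m + n - 1) h (tot m n f g) +
       sg ((m - 1) * (n - 1)) (tot (n + p - 1) m (tot p n h g) f - tot p (m + n - 1) h (tot n m g f))"
    using fgh ghf hfg by (simp_all add: algebra_simps)
  have comm: "n + m - 1 = m + n - 1" "p + m - 1 = m + p - 1" "p + n - 1 = n + p - 1" by simp_all
  show ?thesis
    unfolding bracket_def tot_diff tot_sg comm eqs
    by (cases "even m"; cases "even n"; cases "even p") (simp_all add: sg_def)
qed

lemma brace_binary: "brace 2 m n h f g = pc (n + 1) m 0 (pc 2 n 1 h g) f"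
proof -
  have "{0..<2::int} = {0, 1}" "{0..<1::int} = {0}" by auto
  then show ?thesis by (simp add: brace_def add.commute)
qed

text \<open>
  An element of degree 2 has only two inputs. This is why braces of \<open>\<mu>\<close> with three arguments
  disappear from the formulas below.
\<close>

lemma brace3_binary: "brace3 2 l m n h e f g = 0"
  unfolding brace3_def by (intro sum.neutral ballI) auto

end

section \<open>The differential and the cup product of cochains\<close>

locale graded_compositions_mult = graded_compositions +
  fixes \<mu>
  assumes tot_mu_mu: "tot 2 2 \<mu> \<mu> = 0"
begin

definition cup :: "int \<Rightarrow> int \<Rightarrow> 'a \<Rightarrow> 'a \<Rightarrow> 'a" where
  "cup m n f g = sg m (pc (m + 1) n m (pc 2 m 0 \<mu> f) g)"

definition d :: "int \<Rightarrow> 'a \<Rightarrow> 'a" where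
  "d m f = - bracket m 2 f \<mu>"

lemma cup_eq_brace: "cup m n f g = sg (m + (m - 1) * (n - 1)) (brace 2 m n \<mu> f g)"
proof -
  have "pc (n + 1) m 0 (pc 2 n 1 \<mu> g) f = sg ((n - 1) * (m - 1)) (pc (m + 1) n m (pc 2 m 0 \<mu> f) g)"
    using pc_before[of 0 1 2 n m \<mu> g f] by (simp add: add.commute)
  then show ?thesis by (simp add: cup_def brace_binary sg_def mult.commute)
qed

lemma d_eq: "d m f = - tot m 2 f \<mu> + sg (m - 1) (tot 2 m \<mu> f)"
  by (simp add: d_def bracket_def)

lemma d_minus: "d m (- f) = - d m f"
  by (simp add: d_def bracket_minus)

lemma d_sg: "d m (sg e f) = sg e (d m f)"
  by (simp add: sg_def d_minus)

text \<open>
  For \<open>g = \<mu>\<close> of odd reduced degree the two braces in the associator \<open>tot_tot\<close> of \<open>f, \<mu>, \<mu>\<close> are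
  equal with opposite signs. So \<open>(f \<bullet> \<mu>) \<bullet> \<mu> = f \<bullet> (\<mu> \<bullet> \<mu>) = 0\<close> in every characteristic,
  whereas the graded symmetry of the associator alone would only give twice this equation. The
  other braces come from the associators of \<open>\<mu>, f, \<mu>\<close> and of \<open>\<mu>, \<mu>, f\<close> and cancel.
\<close>

lemma d_d: "d (m + 1) (d m f) = 0"
proof -
  have eqs: "tot (m + 1) 2 (tot m 2 f \<mu>) \<mu> = 0"
    "tot (m + 1) 2 (tot 2 m \<mu> f) \<mu> = tot 2 (m + 1) \<mu> (tot m 2 f \<mu>) + brace 2 2 m \<mu> \<mu> f +
       sg (m - 1) (brace 2 m 2 \<mu> f \<mu>)"
    "tot 2 (m + 1) \<mu> (tot 2 m \<mu> f) = - brace 2 m 2 \<mu> f \<mu> - sg (m - 1) (brace 2 2 m \<mu> \<mu> f)"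
    using tot_tot[of m 2 2 f \<mu> \<mu>] tot_tot[of 2 m 2 \<mu> f \<mu>] tot_tot[of 2 2 m \<mu> \<mu> f]
    by (simp_all add: tot_mu_mu add.commute eq_neg_iff_add_eq_0 sg_def algebra_simps split: if_splits)
  show ?thesis
    by (cases "even m") (simp_all add: d_eq tot_add tot_minus tot_diff tot_sg eqs sg_def)
qed

text \<open>
  The Jacobi identity with \<open>\<mu>\<close> as third argument.
\<close>

lemma d_bracket:
  "d (m + n - 1) (bracket m n f g) =
     bracket m (n + 1) f (d n g) + sg (n - 1) (bracket (m + 1) n (d m f) g)"
proof -
  have "sg (m - 1) (bracket (m + n - 1) 2 (bracket m n f g) \<mu>) +
   sg ((n - 1) * (m - 1)) (bracket (n + 1) m (bracket n 2 g \<mu>) f) +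
   sg (n - 1) (bracket (m + 1) n (bracket 2 m \<mu> f) g) = 0"
    using bracket_jacobi[of m 2 n f g \<mu>] by (simp add: add.commute)
  moreover have "bracket (n + 1) m (bracket n 2 g \<mu>) f =
      - sg (n * (m - 1)) (bracket m (n + 1) f (bracket n 2 g \<mu>))"
    by (subst bracket_antisym) simp
  moreover have "bracket 2 m \<mu> f = - sg (m - 1) (bracket m 2 f \<mu>)"
    by (subst bracket_antisym) simp
  ultimately show ?thesis
    by (cases "even m"; cases "even n")
      (auto simp add: d_def bracket_minus sg_def algebra_simps)
qed

lemma d_neg: "m < 0 \<Longrightarrow> d m f = 0"
  by (simp add: d_eq tot_neg)

lemma cup_neg: "m < 0 \<or> n < 0 \<Longrightarrow> cup m n f g = 0"
  by (auto simp: cup_def pc_outside)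

lemma cup_zero [simp]: "cup m n 0 g = 0" "cup m n f 0 = 0"
  by (simp_all add: cup_def)

text \<open>
  The term \<open>\<mu>\<langle>f, g\<rangle> \<bullet> \<mu>\<close> is expanded by \<open>tot_brace\<close>, and \<open>\<mu> \<bullet> \<mu>\<langle>f, g\<rangle>\<close> is solved for in the
  expansion of \<open>(\<mu> \<bullet> \<mu>)\<langle>f, g\<rangle> = 0\<close> by \<open>brace_tot\<close>.
\<close>

lemma d_cup:
  "d (m + n) (cup m n f g) = sg n (cup (m + 1) n (d m f) g) + cup m (n + 1) f (d n g)"
proof (cases "0 \<le> m \<and> 0 \<le> n")
  case True
  then have nonneg: "0 \<le> m" "0 \<le> n" by simp_all
  have right: "tot (m + n) 2 (brace 2 m n \<mu> f g) \<mu> =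
      brace 2 (m + 1) n \<mu> (tot m 2 f \<mu>) g + sg (m - 1) (brace 2 m (n + 1) \<mu> f (tot n 2 g \<mu>))"
    using tot_brace[OF nonneg, of 2 2 \<mu> f g \<mu>] by (simp add: brace3_binary add.commute)
  have left: "tot 2 (m + n) \<mu> (brace 2 m n \<mu> f g) =
      - brace 2 m (n + 1) \<mu> f (tot 2 n \<mu> g) - sg (n - 1) (brace 2 (m + 1) n \<mu> (tot 2 m \<mu> f) g)"
    using brace_tot[of 2 n 2 m \<mu> \<mu> f g] nonneg
    by (simp add: brace3_binary tot_mu_mu algebra_simps eq_neg_iff_add_eq_0)
  show ?thesis
    unfolding cup_eq_brace d_sg d_eq right left tot_sg brace_sg brace_add brace_minus
    by (cases "even m"; cases "even n") (simp_all add: sg_def)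
next
  case False
  then show ?thesis
    by (auto simp: cup_neg d_neg not_le) (simp_all add: d_eq)
qed

text \<open>
  Each side is a sign times \<open>((\<mu> \<circ>\<^sub>i \<mu>) \<circ>\<^sub>0 f) \<circ>\<^sub>m g\<close> composed with \<open>h\<close>, where \<open>i = 0\<close> on the left and
  \<open>i = 1\<close> on the right; \<open>\<mu> \<bullet> \<mu> = 0\<close> says that these two compositions of \<open>\<mu>\<close> with itself are
  negatives of each other.
\<close>

lemma cup_assoc:
  "cup (m + n) p (cup m n f g) h = cup m (n + p) f (cup n p g h)"
proof (cases "0 \<le> m \<and> 0 \<le> n \<and> 0 \<le> p")
  case True
  have two: "{0..<2::int} = {0, 1}" by auto
  have mu: "pc 2 2 1 \<mu> \<mu> = - pc 2 2 0 \<mu> \<mu>"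
    using tot_mu_mu by (simp add: tot_def two eq_neg_iff_add_eq_0 add.commute)
  have "pc 2 (m + n) 0 \<mu> (pc (m + 1) n m (pc 2 m 0 \<mu> f) g) =
      pc (m + 2) n m (pc 2 (m + 1) 0 \<mu> (pc 2 m 0 \<mu> f)) g"
    using pc_nested[of 0 m "m + 1" 2 n \<mu> "pc 2 m 0 \<mu> f" g] True by (simp add: add.commute)
  also have "pc 2 (m + 1) 0 \<mu> (pc 2 m 0 \<mu> f) = pc 3 m 0 (pc 2 2 0 \<mu> \<mu>) f"
    using pc_nested[of 0 0 2 2 m \<mu> \<mu> f] by (simp add: add.commute)
  finally have left: "pc 2 (m + n) 0 \<mu> (pc (m + 1) n m (pc 2 m 0 \<mu> f) g) =
      pc (m + 2) n m (pc 3 m 0 (pc 2 2 0 \<mu> \<mu>) f) g" .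
  have "pc (m + 1) (n + p) m (pc 2 m 0 \<mu> f) (pc (n + 1) p n (pc 2 n 0 \<mu> g) h) =
      pc (m + n + 1) p (m + n) (pc (m + 1) (n + 1) m (pc 2 m 0 \<mu> f) (pc 2 n 0 \<mu> g)) h"
    using pc_nested[of m "m + n" "n + 1" "m + 1" p "pc 2 m 0 \<mu> f" "pc 2 n 0 \<mu> g" h] True
    by (simp add: ac_simps)
  also have "pc (m + 1) (n + 1) m (pc 2 m 0 \<mu> f) (pc 2 n 0 \<mu> g) =
      pc (m + 2) n m (pc (m + 1) 2 m (pc 2 m 0 \<mu> f) \<mu>) g"
    using pc_nested[of m m 2 "m + 1" n "pc 2 m 0 \<mu> f" \<mu> g] by (simp add: add.commute)
  also have "pc (m + 1) 2 m (pc 2 m 0 \<mu> f) \<mu> = sg m (pc 3 m 0 (pc 2 2 0 \<mu> \<mu>) f)"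
    using pc_after[of 0 1 2 m 2 \<mu> f \<mu>]
    by (simp add: add.commute mu pc_minus) (simp add: sg_def)
  finally have right: "pc (m + 1) (n + p) m (pc 2 m 0 \<mu> f) (pc (n + 1) p n (pc 2 n 0 \<mu> g) h) =
      sg m (pc (m + n + 1) p (m + n) (pc (m + 2) n m (pc 3 m 0 (pc 2 2 0 \<mu> \<mu>) f) g) h)"
    by (simp add: pc_sg)
  show ?thesis
    unfolding cup_def pc_sg left right by (simp add: sg_def)
next
  case False
  then show ?thesis by (auto simp: cup_neg)
qed

text \<open>
  The failure of \<open>\<delta>\<close> to be a derivation of \<open>\<bullet>\<close> comes from the associator of \<open>\<mu>, f, g\<close>, whose
  braces \<open>\<mu>\<langle>g, f\<rangle>\<close> and \<open>\<mu>\<langle>f, g\<rangle>\<close> are the two cup products; the braces of \<open>f\<close> with \<open>\<mu>\<close> and \<open>g\<close>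
  cancel.
\<close>

lemma d_tot:
  "d (m + n - 1) (tot m n f g) =
     tot m (n + 1) f (d n g) + sg (n - 1) (tot (m + 1) n (d m f) g) +
     sg (n - 1) (cup m n f g - sg (m * n) (cup n m g f))"
proof -
  have eqs:
    "tot (m + n - 1) 2 (tot m n f g) \<mu> = tot m (n + 1) f (tot n 2 g \<mu>) + brace m 2 n f \<mu> g +
       sg (n - 1) (brace m n 2 f g \<mu>)"
    "tot (m + 1) n (tot m 2 f \<mu>) g = tot m (n + 1) f (tot 2 n \<mu> g) + brace m n 2 f g \<mu> +
       sg (n - 1) (brace m 2 n f \<mu> g)"
    "tot (m + 1) n (tot 2 m \<mu> f) g = tot 2 (m + n - 1) \<mu> (tot m n f g) + brace 2 n m \<mu> g f +
       sg ((m - 1) * (n - 1)) (brace 2 m n \<mu> f g)"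
    using tot_tot[of m n 2 f g \<mu>] tot_tot[of m 2 n f \<mu> g] tot_tot[of 2 m n \<mu> f g]
    by (simp_all add: add.commute)
  show ?thesis
    unfolding cup_eq_brace d_eq tot_add tot_minus tot_sg eqs
    by (cases "even m"; cases "even n") (simp_all add: sg_def algebra_simps)
qed

text \<open>
  For cocycles only the last term on the right remains, and \<open>h\<langle>f, g\<rangle>\<close> is a homotopy for the
  Leibniz rule. The four equations in the proof are the expansions of \<open>h\<langle>f, g\<rangle> \<bullet> \<mu>\<close>,
  \<open>(h \<bullet> \<mu>)\<langle>f, g\<rangle>\<close>, \<open>(\<mu> \<bullet> h)\<langle>f, g\<rangle>\<close> and \<open>\<mu>\<langle>f, g\<rangle> \<bullet> h\<close>. The three-fold braces of \<open>h\<close> with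
  \<open>\<mu>, f, g\<close> occur in the first two and cancel between them.
\<close>

lemma d_brace:
  "d (p + m + n - 2) (brace p m n h f g) =
     brace p (m + 1) n h (d m f) g + sg (m - 1) (brace p m (n + 1) h f (d n g)) +
     sg (m + n) (brace (p + 1) m n (d p h) f g) +
     sg (m * n + m + 1) (bracket p (m + n) h (cup m n f g)
       - cup (p + m - 1) n (bracket p m h f) g
       - sg ((p - 1) * m) (cup m (p + n - 1) f (bracket p n h g)))"
proof (cases "0 \<le> p \<and> 0 \<le> m \<and> 0 \<le> n")
  case True
  then have nonneg: "0 \<le> p" "0 \<le> m" "0 \<le> n" by simp_all
  have eqs:
    "tot (p + m + n - 2) 2 (brace p m n h f g) \<mu> =
       brace3 p 2 m n h \<mu> f g + brace p (m + 1) n h (tot m 2 f \<mu>) g +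
       sg (m - 1) (brace3 p m 2 n h f \<mu> g + brace p m (n + 1) h f (tot n 2 g \<mu>)) +
       sg (m + n) (brace3 p m n 2 h f g \<mu>)"
    "brace (p + 1) m n (tot p 2 h \<mu>) f g =
       brace3 p m n 2 h f g \<mu> + brace p m (n + 1) h f (tot 2 n \<mu> g) +
       tot p (m + n) h (brace 2 m n \<mu> f g) +
       sg (n - 1) (brace3 p m 2 n h f \<mu> g + brace p (m + 1) n h (tot 2 m \<mu> f) g) +
       sg (m + n) (brace3 p 2 m n h \<mu> f g)"
    "tot 2 (p + m + n - 2) \<mu> (brace p m n h f g) =
       brace (p + 1) m n (tot 2 p \<mu> h) f g - brace 2 m (p + n - 1) \<mu> f (tot p n h g) -
       sg ((p - 1) * (n - 1)) (brace 2 (p + m - 1) n \<mu> (tot p m h f) g)"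
    "tot (m + n) p (brace 2 m n \<mu> f g) h =
       brace 2 (p + m - 1) n \<mu> (tot m p f h) g +
       sg ((p - 1) * (m - 1)) (brace 2 m (p + n - 1) \<mu> f (tot n p g h))"
    using tot_brace[of m n p 2 h f g \<mu>] brace_tot[of 2 n p m h \<mu> f g]
      brace_tot[of p n 2 m \<mu> h f g] tot_brace[of m n 2 p \<mu> f g h] nonneg
    by (simp_all add: brace3_binary ac_simps sg_def)
  show ?thesis
    unfolding cup_eq_brace d_eq bracket_def tot_sg brace_sg brace_add brace_minus brace_diff eqs
    by (cases "even m"; cases "even n"; cases "even p") (simp_all add: sg_def algebra_simps)
next
  case False
  then show ?thesis
    by (auto simp: cup_neg d_neg brace_neg bracket_def tot_neg not_le) (simp_all add: d_eq)
qed

end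

section \<open>An abelian group containing all components of a pre-operad\<close>

text \<open>
  The product of all abelian groups \<open>M\<close> on subsets of the type \<open>'c\<close>, where \<open>M\<close> ranges over all
  records of module type. Records that are not abelian groups contribute a one-point factor, so
  that elements are determined by their components. Since the product is taken over all groups
  at once, the type depends on no particular pre-operad.
\<close>

typedef ('k, 'c) ambient =
  "{F :: ('k, 'c) module \<Rightarrow> 'c.
      \<forall>M. F M \<in> (if abelian_group M then carrier M else {undefined})}"
  morphisms component Ambient
  by (rule exI[of _ "\<lambda>M. if abelian_group M then \<zero>\<^bsub>M\<^esub> else undefined"])
    (auto dest: abelian_groupE)

lemma component_carrier: "abelian_group M \<Longrightarrow> component F M \<in> carrier M"
  using component[of F] by (auto split: if_splits)

lemma component_undefined: "\<not> abelian_group M \<Longrightarrow> component F M = undefined"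
  using component[of F] by (auto split: if_splits dest!: spec[of _ M])

lemma ambient_eqI:
  "(\<And>M. abelian_group M \<Longrightarrow> component F M = component G M) \<Longrightarrow> F = G"
  by (metis component_inject component_undefined ext)

lemma component_Ambient:
  assumes "abelian_group M" "\<And>M. abelian_group M \<Longrightarrow> F M \<in> carrier M"
  shows "component (Ambient (\<lambda>M. if abelian_group M then F M else undefined)) M = F M"
  using assms by (subst Ambient_inverse) auto

instantiation ambient :: (type, type) ab_group_add
begin

definition "0 = Ambient (\<lambda>M. if abelian_group M then \<zero>\<^bsub>M\<^esub> else undefined)"
definition "F + G = Ambient (\<lambda>M. if abelian_group M
    then component F M \<oplus>\<^bsub>M\<^esub> component G M else undefined)"
definition "- F = Ambient (\<lambda>M. if abelian_group M then \<ominus>\<^bsub>M\<^esub> component F M else undefined)"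
definition "F - G = F + - (G :: ('a, 'b) ambient)"

lemma component_simps:
  assumes "abelian_group M"
  shows component_zero: "component 0 M = \<zero>\<^bsub>M\<^esub>"
    and component_add: "component (F + G) M = component F M \<oplus>\<^bsub>M\<^esub> component G M"
    and component_minus: "component (- F) M = \<ominus>\<^bsub>M\<^esub> component F M"
  unfolding zero_ambient_def plus_ambient_def uminus_ambient_def
  using assms
  by (simp_all add: component_Ambient component_carrier abelian_groupE abelian_group.a_inv_closed)

instance
proof
  fix F G H :: "('a, 'b) ambient"
  show "F + G + H = F + (G + H)"
    by (rule ambient_eqI)
      (simp add: component_simps abelian_groupE(3) component_carrier)
  show "F + G = G + F"
    by (rule ambient_eqI)
      (simp add: component_simps abelian_groupE(4) component_carrier)
  show "0 + F = F"
    by (rule ambient_eqI)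
      (simp add: component_simps abelian_groupE(5) component_carrier)
  show "- F + F = 0"
    by (rule ambient_eqI)
      (simp add: component_simps abelian_group.l_neg component_carrier)
  show "F - G = F + - G"
    by (fact minus_ambient_def)
qed

end

definition emb :: "('k, 'c) module \<Rightarrow> 'c \<Rightarrow> ('k, 'c) ambient" where
  "emb M x = Ambient (\<lambda>N. if abelian_group N then (if N = M then x else \<zero>\<^bsub>N\<^esub>) else undefined)"

context
  fixes M :: "('k, 'c) module"
  assumes M: "abelian_group M"
begin

interpretation abelian_group M by (fact M)

lemma component_emb:
  assumes "x \<in> carrier M" "abelian_group N"
  shows "component (emb M x) N = (if N = M then x else \<zero>\<^bsub>N\<^esub>)"
  unfolding emb_def using assms by (subst component_Ambient) (auto dest: abelian_groupE)

lemma emb_inject: "x \<in> carrier M \<Longrightarrow> y \<in> carrier M \<Longrightarrow> emb M x = emb M y \<longleftrightarrow> x = y"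
  using component_emb[OF _ M] by metis

lemma emb_zero: "emb M \<zero>\<^bsub>M\<^esub> = 0"
  by (rule ambient_eqI) (simp add: component_emb component_zero)

lemma emb_add: "x \<in> carrier M \<Longrightarrow> y \<in> carrier M \<Longrightarrow> emb M (x \<oplus>\<^bsub>M\<^esub> y) = emb M x + emb M y"
  by (rule ambient_eqI) (simp add: component_emb component_add abelian_groupE)

lemma emb_uminus:
  assumes "x \<in> carrier M" shows "emb M (\<ominus>\<^bsub>M\<^esub> x) = - emb M x"
proof -
  have "emb M (\<ominus>\<^bsub>M\<^esub> x) + emb M x = 0"
    using assms by (simp add: emb_add[symmetric] l_neg emb_zero)
  then show ?thesis by (simp add: eq_neg_iff_add_eq_0)
qed

lemma emb_minus: "x \<in> carrier M \<Longrightarrow> y \<in> carrier M \<Longrightarrow> emb M (x \<ominus>\<^bsub>M\<^esub> y) = emb M x - emb M y"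
  by (simp add: a_minus_def emb_add emb_uminus)

lemma emb_signed: "x \<in> carrier M \<Longrightarrow> emb M (signed M e x) = sg e (emb M x)"
  by (simp add: signed_def sg_def emb_uminus)

lemma emb_finsum: "f \<in> A \<rightarrow> carrier M \<Longrightarrow> emb M (\<Oplus>\<^bsub>M\<^esub>i\<in>A. f i) = (\<Sum>i\<in>A. emb M (f i))"
  by (induction A rule: infinite_finite_induct)
    (simp_all add: emb_zero finsum_infinite emb_add Pi_def)

lemma signed_closed: "x \<in> carrier M \<Longrightarrow> signed M e x \<in> carrier M"
  by (simp add: signed_def)

end

text \<open>
  Only the components of \<open>F\<close> and \<open>G\<close> in \<open>C\<^sup>m\<close> and \<open>C\<^sup>n\<close> are composed; the others are ignored. This
  makes the operation biadditive on the whole ambient group.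
\<close>

definition ambient_comp ::
  "('k, 'c) pre_operad \<Rightarrow> int \<Rightarrow> int \<Rightarrow> int \<Rightarrow> ('k, 'c) ambient \<Rightarrow> ('k, 'c) ambient \<Rightarrow> ('k, 'c) ambient"
where
  "ambient_comp P m n i F G =
     (if 0 \<le> i \<and> i < m \<and> 0 \<le> n
      then emb (cpt P (m + n - 1))
        (pcomp P m n i (component F (cpt P m)) (component G (cpt P n)))
      else 0)"

context linear_pre_operad
begin

abbreviation \<epsilon> :: "int \<Rightarrow> 'c \<Rightarrow> ('k, 'c) ambient" where
  "\<epsilon> n \<equiv> emb (cpt P n)"

abbreviation C :: "int \<Rightarrow> 'c set" where
  "C n \<equiv> carrier (cpt P n)"

lemma cpt_group: "abelian_group (cpt P n)"
  using cpt_module[of n] by (simp add: module_def)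

lemma pcomp_closed:
  "0 \<le> i \<Longrightarrow> i < m \<Longrightarrow> 0 \<le> n \<Longrightarrow> f \<in> C m \<Longrightarrow> g \<in> C n \<Longrightarrow> pcomp P m n i f g \<in> C (m + n - 1)"
  using pcomp_bilinear[of m n i] by (simp add: bilinear_map_def)

lemma emb_pcomp:
  assumes "0 \<le> i" "i < m" "0 \<le> n" "f \<in> C m" "g \<in> C n"
  shows "\<epsilon> (m + n - 1) (pcomp P m n i f g) = ambient_comp P m n i (\<epsilon> m f) (\<epsilon> n g)"
  using assms by (simp add: ambient_comp_def component_emb cpt_group)

lemma ambient_comp_add:
  "ambient_comp P m n i (F + F') G = ambient_comp P m n i F G + ambient_comp P m n i F' G"
  "ambient_comp P m n i F (G + G') = ambient_comp P m n i F G + ambient_comp P m n i F G'"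
  using pcomp_bilinear[of m n i]
  by (auto simp: ambient_comp_def bilinear_map_def component_add component_carrier cpt_group
      emb_add[symmetric])

lemma ambient_comp_zero: "ambient_comp P m n i 0 G = 0" "ambient_comp P m n i F 0 = 0"
  using ambient_comp_add(1)[of m n i 0 0 G] ambient_comp_add(2)[of m n i F 0 0] by simp_all

lemma ambient_comp_outside: "\<not> (0 \<le> i \<and> i < m \<and> 0 \<le> n) \<Longrightarrow> ambient_comp P m n i F G = 0"
  by (auto simp: ambient_comp_def)

sublocale ambient: graded_compositions "ambient_comp P"
proof
  fix p m n i j :: int and h f g :: "('k, 'c) ambient"
  \<comment> \<open>All sides of the axioms depend only on these components. The bounds of the operadic axioms
    fail exactly when a composition on each side is out of range, hence zero.\<close>
  let ?h = "component h (cpt P p)" and ?f = "component f (cpt P m)" and ?g = "component g (cpt P n)"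
  have deg: "p + m - 1 + n - 1 = p + m + n - 2" "p + n - 1 + m - 1 = p + m + n - 2"
    "p + (m + n - 1) - 1 = p + m + n - 2" "i + (n - 1) = i + n - 1" by simp_all
  have carr: "?h \<in> C p" "?f \<in> C m" "?g \<in> C n"
    by (simp_all add: component_carrier cpt_group)
  show "ambient_comp P (p + m - 1) n j (ambient_comp P p m i h f) g =
        sg ((m - 1) * (n - 1))
          (ambient_comp P (p + n - 1) m (i + n - 1) (ambient_comp P p n j h g) f)"
    if "j < i"
  proof (cases "0 \<le> j \<and> i < p \<and> 0 \<le> m \<and> 0 \<le> n")
    case True
    have "ambient_comp P (p + m - 1) n j (ambient_comp P p m i h f) g =
        \<epsilon> (p + m + n - 2) (pcomp P (p + m - 1) n j (pcomp P p m i ?h ?f) ?g)"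
      using True that by (simp add: ambient_comp_def component_emb cpt_group pcomp_closed carr
          deg)
    also have "\<dots> = \<epsilon> (p + m + n - 2) (signed (cpt P (p + m + n - 2)) ((m - 1) * (n - 1))
              (pcomp P (p + n - 1) m (i + (n - 1)) (pcomp P p n j ?h ?g) ?f))"
      using True that carr by (subst pcomp_before) auto
    also have "\<dots> = sg ((m - 1) * (n - 1)) (\<epsilon> (p + n - 1 + m - 1)
        (pcomp P (p + n - 1) m (i + n - 1) (pcomp P p n j ?h ?g) ?f))"
    proof -
      have "pcomp P (p + n - 1) m (i + n - 1) (pcomp P p n j ?h ?g) ?f \<in> C (p + n - 1 + m - 1)"
        using True that by (intro pcomp_closed carr) auto
      then show ?thesis
        by (simp add: emb_signed cpt_group deg)
    qed
    also have "\<dots> = sg ((m - 1) * (n - 1))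
        (ambient_comp P (p + n - 1) m (i + n - 1) (ambient_comp P p n j h g) f)"
      using True that by (simp add: ambient_comp_def component_emb cpt_group pcomp_closed carr)
    finally show ?thesis .
  next
    case False
    then have "ambient_comp P (p + m - 1) n j (ambient_comp P p m i h f) g = 0"
      using that by (cases "i < p \<and> 0 \<le> m"; cases "0 \<le> j \<and> 0 \<le> n")
        (auto simp: ambient_comp_outside ambient_comp_zero)
    moreover have "ambient_comp P (p + n - 1) m (i + n - 1) (ambient_comp P p n j h g) f = 0"
      using False that by (cases "0 \<le> j \<and> 0 \<le> n"; cases "i < p \<and> 0 \<le> m")
        (auto simp: ambient_comp_outside ambient_comp_zero)
    ultimately show ?thesis by simp
  qed
  show "ambient_comp P (p + m - 1) n j (ambient_comp P p m i h f) g =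
        ambient_comp P p (m + n - 1) i h (ambient_comp P m n (j - i) f g)"
    if "i \<le> j" "j < i + m"
  proof (cases "0 \<le> i \<and> i < p \<and> 0 \<le> n")
    case True
    have "ambient_comp P (p + m - 1) n j (ambient_comp P p m i h f) g =
        \<epsilon> (p + m + n - 2) (pcomp P (p + m - 1) n j (pcomp P p m i ?h ?f) ?g)"
      using True that by (simp add: ambient_comp_def component_emb cpt_group pcomp_closed carr
          deg)
    also have "\<dots> = \<epsilon> (p + m + n - 2) (pcomp P p (m + n - 1) i ?h (pcomp P m n (j - i) ?f ?g))"
      using True that carr by (subst pcomp_nested) auto
    also have "\<dots> = ambient_comp P p (m + n - 1) i h (ambient_comp P m n (j - i) f g)"
      using True that by (simp add: ambient_comp_def component_emb cpt_group pcomp_closed carr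
          deg)
    finally show ?thesis .
  next
    case False
    then show ?thesis
      using that by (cases "0 \<le> n") (auto simp: ambient_comp_outside ambient_comp_zero)
  qed
qed (simp_all add: ambient_comp_add ambient_comp_outside)

end

section \<open>Bilinearity of the operations\<close>

text \<open>
  \<open>\<delta>\<close> and the two products are bilinear over \<open>K\<close> because they are built by the following
  operations from partial compositions.
\<close>

lemma bilinear_flip: "bilinear_map K M N Q \<beta> \<Longrightarrow> bilinear_map K N M Q (\<lambda>x y. \<beta> y x)"
  by (simp add: bilinear_map_def)

lemma bilinear_zero: "module K Q \<Longrightarrow> bilinear_map K M N Q (\<lambda>x y. \<zero>\<^bsub>Q\<^esub>)"
proof -
  assume "module K Q"
  then interpret Q: module K Q .
  show ?thesis by (simp add: bilinear_map_def)
qed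

lemma bilinear_closed: "bilinear_map K M N Q \<beta> \<Longrightarrow> x \<in> carrier M \<Longrightarrow> y \<in> carrier N \<Longrightarrow> \<beta> x y \<in> carrier Q"
  by (simp add: bilinear_map_def)

lemma bilinear_minus:
  assumes "module K Q" "bilinear_map K M N Q \<beta>"
  shows "bilinear_map K M N Q (\<lambda>x y. \<ominus>\<^bsub>Q\<^esub> \<beta> x y)"
proof -
  interpret Q: module K Q by fact
  show ?thesis
    using assms(2) by (simp add: bilinear_map_def Q.smult_r_minus Q.minus_add)
qed

lemma bilinear_signed:
  "module K Q \<Longrightarrow> bilinear_map K M N Q \<beta> \<Longrightarrow> bilinear_map K M N Q (\<lambda>x y. signed Q e (\<beta> x y))"
  by (cases "even e") (simp_all add: signed_def bilinear_minus)

lemma bilinear_diff: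
  assumes "module K Q" "bilinear_map K M N Q \<beta>" "bilinear_map K M N Q \<gamma>"
  shows "bilinear_map K M N Q (\<lambda>x y. \<beta> x y \<ominus>\<^bsub>Q\<^esub> \<gamma> x y)"
proof -
  interpret Q: module K Q by fact
  show ?thesis
    using assms(2,3)
    by (simp add: bilinear_map_def a_minus_def Q.smult_r_minus Q.smult_r_distr Q.minus_add Q.a_ac)
qed

lemma bilinear_finsum:
  assumes "module K Q" "finite A" "\<And>i. i \<in> A \<Longrightarrow> bilinear_map K M N Q (\<beta> i)"
  shows "bilinear_map K M N Q (\<lambda>x y. \<Oplus>\<^bsub>Q\<^esub>i\<in>A. \<beta> i x y)"
proof -
  interpret Q: module K Q by fact
  have closed: "(\<lambda>i. \<beta> i x y) \<in> A \<rightarrow> carrier Q" if "x \<in> carrier M" "y \<in> carrier N" for x y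
    using assms(3) that by (auto simp: bilinear_map_def)
  have cong: "(\<Oplus>\<^bsub>Q\<^esub>i\<in>A. F i) = (\<Oplus>\<^bsub>Q\<^esub>i\<in>A. G i)"
    if "\<And>i. i \<in> A \<Longrightarrow> F i = G i" "\<And>i. i \<in> A \<Longrightarrow> G i \<in> carrier Q" for F G
    using that by (intro Q.finsum_cong') auto
  show ?thesis
    unfolding bilinear_map_def
  proof (intro conjI ballI)
    fix x y
    assume xy: "x \<in> carrier M" "y \<in> carrier N"
    show "(\<Oplus>\<^bsub>Q\<^esub>i\<in>A. \<beta> i x y) \<in> carrier Q"
      using closed xy by (intro Q.finsum_closed)
  next
    fix x x' y
    assume xy: "x \<in> carrier M" "x' \<in> carrier M" "y \<in> carrier N"
    have "(\<Oplus>\<^bsub>Q\<^esub>i\<in>A. \<beta> i (x \<oplus>\<^bsub>M\<^esub> x') y) = (\<Oplus>\<^bsub>Q\<^esub>i\<in>A. \<beta> i x y \<oplus>\<^bsub>Q\<^esub> \<beta> i x' y)"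
      using assms(3) xy by (intro cong) (auto simp: bilinear_map_def)
    then show "(\<Oplus>\<^bsub>Q\<^esub>i\<in>A. \<beta> i (x \<oplus>\<^bsub>M\<^esub> x') y) =
        (\<Oplus>\<^bsub>Q\<^esub>i\<in>A. \<beta> i x y) \<oplus>\<^bsub>Q\<^esub> (\<Oplus>\<^bsub>Q\<^esub>i\<in>A. \<beta> i x' y)"
      using closed xy by (simp add: Q.finsum_addf)
  next
    fix x y y'
    assume xy: "x \<in> carrier M" "y \<in> carrier N" "y' \<in> carrier N"
    have "(\<Oplus>\<^bsub>Q\<^esub>i\<in>A. \<beta> i x (y \<oplus>\<^bsub>N\<^esub> y')) = (\<Oplus>\<^bsub>Q\<^esub>i\<in>A. \<beta> i x y \<oplus>\<^bsub>Q\<^esub> \<beta> i x y')"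
      using assms(3) xy by (intro cong) (auto simp: bilinear_map_def)
    then show "(\<Oplus>\<^bsub>Q\<^esub>i\<in>A. \<beta> i x (y \<oplus>\<^bsub>N\<^esub> y')) =
        (\<Oplus>\<^bsub>Q\<^esub>i\<in>A. \<beta> i x y) \<oplus>\<^bsub>Q\<^esub> (\<Oplus>\<^bsub>Q\<^esub>i\<in>A. \<beta> i x y')"
      using closed xy by (simp add: Q.finsum_addf)
  next
    fix a x y
    assume xy: "a \<in> carrier K" "x \<in> carrier M" "y \<in> carrier N"
    have "(\<Oplus>\<^bsub>Q\<^esub>i\<in>A. \<beta> i (a \<odot>\<^bsub>M\<^esub> x) y) = (\<Oplus>\<^bsub>Q\<^esub>i\<in>A. a \<odot>\<^bsub>Q\<^esub> \<beta> i x y)"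
      "(\<Oplus>\<^bsub>Q\<^esub>i\<in>A. \<beta> i x (a \<odot>\<^bsub>N\<^esub> y)) = (\<Oplus>\<^bsub>Q\<^esub>i\<in>A. a \<odot>\<^bsub>Q\<^esub> \<beta> i x y)"
      using assms(3) xy by (auto intro!: cong simp: bilinear_map_def)
    then show "(\<Oplus>\<^bsub>Q\<^esub>i\<in>A. \<beta> i (a \<odot>\<^bsub>M\<^esub> x) y) = a \<odot>\<^bsub>Q\<^esub> (\<Oplus>\<^bsub>Q\<^esub>i\<in>A. \<beta> i x y)"
      "(\<Oplus>\<^bsub>Q\<^esub>i\<in>A. \<beta> i x (a \<odot>\<^bsub>N\<^esub> y)) = a \<odot>\<^bsub>Q\<^esub> (\<Oplus>\<^bsub>Q\<^esub>i\<in>A. \<beta> i x y)"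
      using closed xy assms(2) by (simp_all add: Q.finsum_smult_ldistr)
  qed
qed

context linear_pre_operad
begin

lemma total_comp_bilinear:
  "bilinear_map K (cpt P m) (cpt P n) (cpt P (m + n - 1)) (total_comp P m n)"
proof (cases "0 \<le> m \<and> 0 \<le> n")
  case True
  have "bilinear_map K (cpt P m) (cpt P n) (cpt P (m + n - 1))
      (\<lambda>f g. \<Oplus>\<^bsub>cpt P (m + n - 1)\<^esub>i\<in>{0..m - 1}. pcomp P m n i f g)"
    using True by (intro bilinear_finsum cpt_module pcomp_bilinear) auto
  then show ?thesis
    unfolding total_comp_def if_P[OF True] .
next
  case False
  then show ?thesis
    unfolding total_comp_def if_not_P[OF False] by (intro bilinear_zero cpt_module)
qed

lemma commutator_bilinear:
  "bilinear_map K (cpt P m) (cpt P n) (cpt P (m + n - 1)) (commutator P m n)"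
proof -
  have "bilinear_map K (cpt P n) (cpt P m) (cpt P (m + n - 1)) (total_comp P n m)"
    using total_comp_bilinear[of n m] by (simp add: add.commute)
  from bilinear_diff[OF cpt_module total_comp_bilinear
      bilinear_signed[OF cpt_module bilinear_flip[OF this]]]
  show ?thesis unfolding commutator_def .
qed

lemma cup_bilinear:
  assumes "\<mu> \<in> C 2"
  shows "bilinear_map K (cpt P m) (cpt P n) (cpt P (m + n)) (cup P \<mu> m n)"
proof (cases "0 \<le> m \<and> 0 \<le> n")
  case True
  have "bilinear_map K (cpt P m) (cpt P n) (cpt P (m + n))
      (\<lambda>f. pcomp P (m + 1) n m (pcomp P 2 m 0 \<mu> f))"
    using pcomp_bilinear[of "m + 1" n m] pcomp_bilinear[of 2 m 0] True assms
    by (simp add: bilinear_map_def add.commute)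
  then show ?thesis
    unfolding cup_def using True by (simp add: bilinear_signed cpt_module)
next
  case False
  then show ?thesis
    unfolding cup_def if_not_P[OF False] by (intro bilinear_zero cpt_module)
qed

lemma total_comp_closed: "f \<in> C m \<Longrightarrow> g \<in> C n \<Longrightarrow> k = m + n - 1 \<Longrightarrow> total_comp P m n f g \<in> C k"
  using bilinear_closed[OF total_comp_bilinear] by simp

lemma commutator_closed: "f \<in> C m \<Longrightarrow> g \<in> C n \<Longrightarrow> k = m + n - 1 \<Longrightarrow> commutator P m n f g \<in> C k"
  using bilinear_closed[OF commutator_bilinear] by simp

lemma cup_closed: "\<mu> \<in> C 2 \<Longrightarrow> f \<in> C m \<Longrightarrow> g \<in> C n \<Longrightarrow> k = m + n \<Longrightarrow> cup P \<mu> m n f g \<in> C k"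
  using bilinear_closed[OF cup_bilinear] by simp

lemma emb_total_comp:
  assumes "f \<in> C m" "g \<in> C n" "k = m + n - 1"
  shows "\<epsilon> k (total_comp P m n f g) = ambient.tot m n (\<epsilon> m f) (\<epsilon> n g)"
proof (cases "0 \<le> m \<and> 0 \<le> n")
  case True
  have "{0..m - 1} = {0..<m}" by auto
  then have "\<epsilon> k (total_comp P m n f g) = (\<Sum>i\<in>{0..<m}. \<epsilon> k (pcomp P m n i f g))"
    using True assms by (simp add: total_comp_def emb_finsum cpt_group pcomp_closed Pi_def)
  also have "\<dots> = ambient.tot m n (\<epsilon> m f) (\<epsilon> n g)"
    unfolding ambient.tot_def using True assms by (intro sum.cong) (auto simp: emb_pcomp)
  finally show ?thesis .
next
  case False
  then show ?thesis
    using assms emb_zero[OF cpt_group] by (auto simp: total_comp_def ambient.tot_neg)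
qed

lemma emb_commutator:
  assumes "f \<in> C m" "g \<in> C n" "k = m + n - 1"
  shows "\<epsilon> k (commutator P m n f g) = ambient.bracket m n (\<epsilon> m f) (\<epsilon> n g)"
  using assms
  by (simp add: commutator_def ambient.bracket_def emb_minus emb_signed signed_closed cpt_group
      total_comp_closed emb_total_comp)

end

locale multiplicative_pre_operad = linear_pre_operad +
  fixes \<mu>
  assumes mu_closed: "\<mu> \<in> carrier (cpt P 2)"
    and mu_squared: "total_comp P 2 2 \<mu> \<mu> = \<zero>\<^bsub>cpt P 3\<^esub>"
begin

sublocale ambient: graded_compositions_mult "ambient_comp P" "\<epsilon> 2 \<mu>"
proof
  show "ambient.tot 2 2 (\<epsilon> 2 \<mu>) (\<epsilon> 2 \<mu>) = 0"
    using emb_total_comp[OF mu_closed mu_closed, of 3]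
    by (simp add: mu_squared emb_zero cpt_group)
qed

lemma emb_cup:
  assumes "f \<in> C m" "g \<in> C n" "k = m + n"
  shows "\<epsilon> k (cup P \<mu> m n f g) = ambient.cup m n (\<epsilon> m f) (\<epsilon> n g)"
proof (cases "0 \<le> m \<and> 0 \<le> n")
  case True
  have f: "pcomp P 2 m 0 \<mu> f \<in> C (m + 1)"
    using pcomp_closed[of 0 2 m \<mu> f] True mu_closed assms by (simp add: add.commute)
  have "pcomp P (m + 1) n m (pcomp P 2 m 0 \<mu> f) g \<in> C (m + n)"
    using pcomp_closed[of m "m + 1" n _ g] True assms f by (simp add: add.commute)
  moreover have "\<epsilon> (m + n) (pcomp P (m + 1) n m (pcomp P 2 m 0 \<mu> f) g) =
      ambient_comp P (m + 1) n m (\<epsilon> (m + 1) (pcomp P 2 m 0 \<mu> f)) (\<epsilon> n g)"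
    using emb_pcomp[of m "m + 1" n _ g] True assms f by (simp add: add.commute)
  moreover have "\<epsilon> (m + 1) (pcomp P 2 m 0 \<mu> f) = ambient_comp P 2 m 0 (\<epsilon> 2 \<mu>) (\<epsilon> m f)"
    using emb_pcomp[of 0 2 m \<mu> f] True assms mu_closed by (simp add: add.commute)
  ultimately show ?thesis
    using True assms by (simp add: cup_def ambient.cup_def emb_signed cpt_group)
next
  case False
  then show ?thesis
    using assms emb_zero[OF cpt_group] by (auto simp: cup_def ambient.cup_neg)
qed

lemma delta_closed: "f \<in> C m \<Longrightarrow> k = m + 1 \<Longrightarrow> delta P \<mu> m f \<in> C k"
  using commutator_closed[OF _ mu_closed, of f m "m + 1"]
  by (simp add: delta_def abelian_group.a_inv_closed cpt_group)

lemma emb_delta: "f \<in> C m \<Longrightarrow> k = m + 1 \<Longrightarrow> \<epsilon> k (delta P \<mu> m f) = ambient.d m (\<epsilon> m f)"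
  by (simp add: delta_def ambient.d_def emb_uminus emb_commutator commutator_closed
      cpt_group mu_closed)

lemma delta_linear:
  assumes "f \<in> C m" "g \<in> C m"
  shows "delta P \<mu> m (f \<oplus>\<^bsub>cpt P m\<^esub> g) = delta P \<mu> m f \<oplus>\<^bsub>cpt P (m + 1)\<^esub> delta P \<mu> m g"
    and "a \<in> carrier K \<Longrightarrow> delta P \<mu> m (a \<odot>\<^bsub>cpt P m\<^esub> f) = a \<odot>\<^bsub>cpt P (m + 1)\<^esub> delta P \<mu> m f"
proof -
  have "bilinear_map K (cpt P m) (cpt P 2) (cpt P (m + 1)) (\<lambda>f \<mu>. \<ominus>\<^bsub>cpt P (m + 1)\<^esub> commutator P m 2 f \<mu>)"
    using commutator_bilinear[of m 2] by (simp add: bilinear_minus cpt_module add.commute)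
  then show "delta P \<mu> m (f \<oplus>\<^bsub>cpt P m\<^esub> g) = delta P \<mu> m f \<oplus>\<^bsub>cpt P (m + 1)\<^esub> delta P \<mu> m g"
    and "a \<in> carrier K \<Longrightarrow> delta P \<mu> m (a \<odot>\<^bsub>cpt P m\<^esub> f) = a \<odot>\<^bsub>cpt P (m + 1)\<^esub> delta P \<mu> m f"
    using assms mu_closed by (simp_all add: bilinear_map_def delta_def)
qed

end

section \<open>Quotient modules\<close>

text \<open>
  The quotient \<open>M / N\<close> is described through the surjection \<open>x \<mapsto> N +> x\<close>, which is compatible with
  all operations; the module laws are inherited from \<open>M\<close> along it.
\<close>

locale module_quotient =
  M: module K M for K :: "('k, 'r) ring_scheme" and M :: "('k, 'c) module" (structure) +
  fixes N
  assumes submodule: "submodule N K M"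
begin

sublocale abelian_subgroup N M
  by (intro abelian_subgroupI3 additive_subgroup.intro submodule.axioms(1)[OF submodule]
      M.abelian_group_axioms)

abbreviation Q :: "('k, 'c set) module" where
  "Q \<equiv> quotient_module M N"

lemma coset_eq_iff:
  assumes "x \<in> carrier M" "y \<in> carrier M"
  shows "N +> x = N +> y \<longleftrightarrow> x \<ominus> y \<in> N"
proof -
  have "N +> x = N +> y \<longleftrightarrow> x \<in> N +> y"
    using a_rcos_self[OF assms(1)] a_repr_independence'[OF _ assms(2)] by auto
  then show ?thesis
    using a_rcos_module[OF assms(2,1)] by (simp add: a_minus_def)
qed

lemma carrier_quotient: "carrier Q = (\<lambda>x. N +> x) ` carrier M"
  by (auto simp: quotient_module_def A_RCOSETS_def RCOSETS_def a_r_coset_def)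

lemma zero_quotient: "\<zero>\<^bsub>Q\<^esub> = N +> \<zero>"
  by (simp add: quotient_module_def a_rcos_const a_subset
      additive_subgroup.zero_closed additive_subgroup_axioms)

lemma add_quotient:
  "x \<in> carrier M \<Longrightarrow> y \<in> carrier M \<Longrightarrow> (N +> x) \<oplus>\<^bsub>Q\<^esub> (N +> y) = N +> (x \<oplus> y)"
  by (simp add: quotient_module_def a_rcos_sum)

lemma smult_quotient:
  assumes "a \<in> carrier K" "x \<in> carrier M"
  shows "a \<odot>\<^bsub>Q\<^esub> (N +> x) = N +> (a \<odot> x)"
proof -
  have "N +> (a \<odot> y) = N +> (a \<odot> x)" if "y \<in> N +> x" for y
  proof -
    have y: "y \<in> carrier M"
      by (rule a_elemrcos_carrier[OF assms(2) that])
    have diff: "y \<ominus> x \<in> N"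
      using that a_rcos_module[OF assms(2) y] by (simp add: a_minus_def)
    have "a \<odot> y \<ominus> a \<odot> x = a \<odot> (y \<ominus> x)"
      using assms y by (simp add: a_minus_def M.smult_r_distr M.smult_r_minus)
    also have "\<dots> \<in> N"
      using submodule.smult_closed[OF submodule assms(1) diff] .
    finally show ?thesis
      using assms y by (subst coset_eq_iff) auto
  qed
  then have "(\<Union>y\<in>N +> x. N +> (a \<odot> y)) = (\<Union>y\<in>N +> x. N +> (a \<odot> x))"
    by (intro SUP_cong refl)
  also have "\<dots> = N +> (a \<odot> x)"
    using a_rcos_self[OF assms(2)] by blast
  finally show ?thesis
    by (simp add: quotient_module_def)
qed

lemmas quotient_simps = zero_quotient add_quotient smult_quotient

lemma quotient_is_module: "module K Q"
proof (rule moduleI)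
  show "cring K" by (fact M.R.is_cring)
  show "abelian_group Q"
  proof (rule abelian_groupI)
    fix X assume "X \<in> carrier Q"
    then obtain x where x: "x \<in> carrier M" "X = N +> x"
      by (auto simp: carrier_quotient)
    show "\<exists>Y\<in>carrier Q. Y \<oplus>\<^bsub>Q\<^esub> X = \<zero>\<^bsub>Q\<^esub>"
      using x by (intro bexI[of _ "N +> (\<ominus> x)"])
        (auto simp: carrier_quotient quotient_simps M.l_neg)
  qed (auto simp: carrier_quotient quotient_simps M.a_ac)
next
  fix a X assume a: "a \<in> carrier K" and "X \<in> carrier Q"
  then obtain x where x: "x \<in> carrier M" "X = N +> x"
    by (auto simp: carrier_quotient)
  show "a \<odot>\<^bsub>Q\<^esub> X \<in> carrier Q"
    using a x by (simp add: carrier_quotient quotient_simps)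
  fix b assume b: "b \<in> carrier K"
  show "(a \<oplus>\<^bsub>K\<^esub> b) \<odot>\<^bsub>Q\<^esub> X = a \<odot>\<^bsub>Q\<^esub> X \<oplus>\<^bsub>Q\<^esub> b \<odot>\<^bsub>Q\<^esub> X"
    using a b x by (simp add: quotient_simps M.smult_l_distr)
  show "(a \<otimes>\<^bsub>K\<^esub> b) \<odot>\<^bsub>Q\<^esub> X = a \<odot>\<^bsub>Q\<^esub> (b \<odot>\<^bsub>Q\<^esub> X)"
    using a b x by (simp add: quotient_simps M.smult_assoc1)
next
  fix X assume "X \<in> carrier Q"
  then obtain x where x: "x \<in> carrier M" "X = N +> x"
    by (auto simp: carrier_quotient)
  show "\<one>\<^bsub>K\<^esub> \<odot>\<^bsub>Q\<^esub> X = X"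
    using x by (simp add: quotient_simps)
next
  fix a X Y assume a: "a \<in> carrier K" and "X \<in> carrier Q" "Y \<in> carrier Q"
  then obtain x y where xy: "x \<in> carrier M" "X = N +> x" "y \<in> carrier M" "Y = N +> y"
    by (auto simp: carrier_quotient)
  show "a \<odot>\<^bsub>Q\<^esub> (X \<oplus>\<^bsub>Q\<^esub> Y) = a \<odot>\<^bsub>Q\<^esub> X \<oplus>\<^bsub>Q\<^esub> a \<odot>\<^bsub>Q\<^esub> Y"
    using a xy by (simp add: quotient_simps M.smult_r_distr)
qed

lemma uminus_quotient:
  assumes "x \<in> carrier M"
  shows "\<ominus>\<^bsub>Q\<^esub> (N +> x) = N +> (\<ominus> x)"
proof -
  interpret Q: module K Q by (fact quotient_is_module)
  show ?thesis
    using assms by (intro Q.minus_equality)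
      (auto simp: quotient_simps carrier_quotient M.l_neg)
qed

end

section \<open>Cohomology\<close>

context linear_pre_operad
begin

lemma zero_in_image: "0 \<in> \<epsilon> n ` C n"
  using emb_zero[OF cpt_group, of n] abelian_groupE(2)[OF cpt_group, of n] by (metis imageI)

lemma ambient_comp_in_image: "ambient_comp P m n i F G \<in> \<epsilon> (m + n - 1) ` C (m + n - 1)"
  unfolding ambient_comp_def
  using pcomp_closed component_carrier[OF cpt_group] by (simp add: zero_in_image)

lemma sum_in_image: "(\<And>x. x \<in> A \<Longrightarrow> F x \<in> \<epsilon> n ` C n) \<Longrightarrow> (\<Sum>x\<in>A. F x) \<in> \<epsilon> n ` C n"
proof (induction A rule: infinite_finite_induct)
  case (insert a A)
  obtain x where x: "F a = \<epsilon> n x" "x \<in> C n"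
    using insert.prems[of a] by auto
  obtain y where y: "(\<Sum>x\<in>A. F x) = \<epsilon> n y" "y \<in> C n"
    using insert.IH insert.prems by blast
  have "(\<Sum>x\<in>insert a A. F x) = \<epsilon> n (x \<oplus>\<^bsub>cpt P n\<^esub> y)"
    using insert.hyps x y by (simp add: emb_add cpt_group)
  moreover have "x \<oplus>\<^bsub>cpt P n\<^esub> y \<in> C n"
    using x y by (simp add: abelian_groupE(1) cpt_group)
  ultimately show ?case by (simp only: imageI)
qed (simp_all add: zero_in_image)

text \<open>
  Braces are formed in the ambient group. To serve as a homotopy, a brace has to come from a
  cochain.
\<close>

lemma brace_in_image:
  assumes "k = p + m + n - 2"
  shows "ambient.brace p m n h f g \<in> \<epsilon> k ` C k"
proof -
  have "k = p + n - 1 + m - 1" using assms by simp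
  then show ?thesis
    unfolding ambient.brace_def using ambient_comp_in_image by (intro sum_in_image) blast
qed

end

context multiplicative_pre_operad
begin

abbreviation "Z \<equiv> cocycles P \<mu>"
abbreviation "B \<equiv> coboundaries P \<mu>"
abbreviation "H \<equiv> cohomology P \<mu>"
abbreviation "cl \<equiv> coh_class P \<mu>"

lemma delta_delta:
  assumes "f \<in> C n"
  shows "delta P \<mu> (n + 1) (delta P \<mu> n f) = \<zero>\<^bsub>cpt P (n + 2)\<^esub>"
proof -
  have "\<epsilon> (n + 2) (delta P \<mu> (n + 1) (delta P \<mu> n f)) = \<epsilon> (n + 2) \<zero>\<^bsub>cpt P (n + 2)\<^esub>"
    using assms by (simp add: emb_delta delta_closed ambient.d_d emb_zero cpt_group)
  then show ?thesis
    using assms by (subst (asm) emb_inject)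
      (auto simp: cpt_group abelian_groupE(2) intro!: delta_closed)
qed

lemma cocycle_iff: "f \<in> Z n \<longleftrightarrow> f \<in> C n \<and> ambient.d n (\<epsilon> n f) = 0"
proof -
  have "delta P \<mu> n f = \<zero>\<^bsub>cpt P (n + 1)\<^esub> \<longleftrightarrow> ambient.d n (\<epsilon> n f) = 0" if "f \<in> C n"
    using that emb_inject[OF cpt_group, of "delta P \<mu> n f" "n + 1" "\<zero>\<^bsub>cpt P (n + 1)\<^esub>"]
    by (simp add: delta_closed abelian_groupE(2) emb_delta emb_zero cpt_group)
  then show ?thesis by (auto simp: cocycles_def)
qed

lemma cocycle_carrier: "f \<in> Z n \<Longrightarrow> f \<in> C n"
  and d_cocycle: "f \<in> Z n \<Longrightarrow> ambient.d n (\<epsilon> n f) = 0"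
  by (simp_all add: cocycle_iff)

lemma coboundaryI:
  assumes "f \<in> C n" "\<epsilon> n f = ambient.d (n - 1) w" "w \<in> \<epsilon> (n - 1) ` C (n - 1)"
  shows "f \<in> B n"
proof -
  obtain g where g: "g \<in> C (n - 1)" "w = \<epsilon> (n - 1) g"
    using assms(3) by auto
  have "\<epsilon> n f = \<epsilon> n (delta P \<mu> (n - 1) g)"
    using g assms(2) by (simp add: emb_delta)
  then have "f = delta P \<mu> (n - 1) g"
    using g assms(1) by (subst (asm) emb_inject) (auto simp: cpt_group intro!: delta_closed)
  then show ?thesis using g by (simp add: coboundaries_def)
qed

lemma coboundaryE:
  assumes "f \<in> B n"
  obtains g where "g \<in> C (n - 1)" "f = delta P \<mu> (n - 1) g" "\<epsilon> n f = ambient.d (n - 1) (\<epsilon> (n - 1) g)"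
  using assms emb_delta[of _ "n - 1" n] by (auto simp: coboundaries_def)

lemma coboundaries_subset: "B n \<subseteq> Z n"
proof
  fix f assume "f \<in> B n"
  then obtain g where "g \<in> C (n - 1)" "f = delta P \<mu> (n - 1) g"
    by (rule coboundaryE)
  then show "f \<in> Z n"
    using delta_delta[of g "n - 1"] delta_closed[of g "n - 1" n]
    by (simp add: cocycles_def add.commute)
qed

lemma cocycles_submodule: "submodule (Z n) K (cpt P n)"
proof -
  interpret Cn: module K "cpt P n" by (fact cpt_module)
  interpret Cn1: module K "cpt P (n + 1)" by (fact cpt_module)
  show ?thesis
  proof (rule Cn.submoduleI)
    show "\<ominus>\<^bsub>cpt P n\<^esub> f \<in> Z n" if "f \<in> Z n" for f
      using that by (simp add: cocycle_iff emb_uminus cpt_group ambient.d_minus)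
    show "\<zero>\<^bsub>cpt P n\<^esub> \<in> Z n"
      by (simp add: cocycle_iff emb_zero cpt_group ambient.d_def ambient.bracket_def)
  qed (auto simp: cocycles_def delta_linear)
qed

lemma coboundaries_submodule: "submodule (B n) K (cpt P n)"
proof -
  interpret Cn: module K "cpt P n" by (fact cpt_module)
  interpret Cn1: module K "cpt P (n - 1)" by (fact cpt_module)
  have cob: "delta P \<mu> (n - 1) f \<in> B n" if "f \<in> C (n - 1)" for f
    using that by (simp add: coboundaries_def)
  have linear: "delta P \<mu> (n - 1) (f \<oplus>\<^bsub>cpt P (n - 1)\<^esub> g) =
        delta P \<mu> (n - 1) f \<oplus>\<^bsub>cpt P n\<^esub> delta P \<mu> (n - 1) g"
      "a \<in> carrier K \<Longrightarrow> delta P \<mu> (n - 1) (a \<odot>\<^bsub>cpt P (n - 1)\<^esub> f) = a \<odot>\<^bsub>cpt P n\<^esub> delta P \<mu> (n - 1) f"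
    if "f \<in> C (n - 1)" "g \<in> C (n - 1)" for f g a
    using delta_linear[of f "n - 1" g] that by simp_all
  show ?thesis
  proof (rule Cn.submoduleI)
    show "B n \<subseteq> C n"
      using coboundaries_subset cocycle_carrier by blast
    show "\<zero>\<^bsub>cpt P n\<^esub> \<in> B n"
      by (rule coboundaryI[of _ _ 0])
        (auto simp: emb_zero cpt_group ambient.d_def ambient.bracket_def
          intro!: image_eqI[of _ _ "\<zero>\<^bsub>cpt P (n - 1)\<^esub>"])
    show "\<ominus>\<^bsub>cpt P n\<^esub> f \<in> B n" if "f \<in> B n" for f
      using that
    proof (rule coboundaryE)
      fix g assume g: "g \<in> C (n - 1)" "f = delta P \<mu> (n - 1) g"
        "\<epsilon> n f = ambient.d (n - 1) (\<epsilon> (n - 1) g)"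
      have "f \<in> C n" using g by (simp add: delta_closed)
      then show ?thesis
        using g by (intro coboundaryI[OF _ _ imageI[of "\<ominus>\<^bsub>cpt P (n - 1)\<^esub> g"]])
          (simp_all add: emb_uminus cpt_group ambient.d_minus)
    qed
    show "f \<oplus>\<^bsub>cpt P n\<^esub> g \<in> B n" if fg: "f \<in> B n" "g \<in> B n" for f g
    proof -
      obtain f' g' where "f' \<in> C (n - 1)" "f = delta P \<mu> (n - 1) f'"
          "g' \<in> C (n - 1)" "g = delta P \<mu> (n - 1) g'"
        using fg by (auto simp: coboundaries_def)
      then show ?thesis by (simp add: linear(1)[symmetric] cob)
    qed
    show "a \<odot>\<^bsub>cpt P n\<^esub> f \<in> B n" if af: "a \<in> carrier K" "f \<in> B n" for a f
    proof -
      obtain f' where "f' \<in> C (n - 1)" "f = delta P \<mu> (n - 1) f'"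
        using af by (auto simp: coboundaries_def)
      then show ?thesis using af by (simp add: linear(2)[symmetric] cob)
    qed
  qed
qed

abbreviation "ZM n \<equiv> cpt P n\<lparr>carrier := Z n\<rparr>"

lemma cocycles_uminus: "f \<in> Z n \<Longrightarrow> \<ominus>\<^bsub>ZM n\<^esub> f = \<ominus>\<^bsub>cpt P n\<^esub> f"
proof -
  assume f: "f \<in> Z n"
  interpret Cn: module K "cpt P n" by (fact cpt_module)
  interpret Zn: module K "ZM n"
    by (rule submodule.submodule_is_module[OF cocycles_submodule cpt_module])
  have "\<ominus>\<^bsub>cpt P n\<^esub> f \<in> Z n"
    using f Cn.submoduleE(3)[OF cocycles_submodule] by simp
  then show ?thesis
    using f cocycle_carrier[OF f] by (intro Zn.minus_equality) (simp_all add: Cn.l_neg)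
qed

lemma quotient: "module_quotient K (ZM n) (B n)"
proof -
  interpret Cn: module K "cpt P n" by (fact cpt_module)
  interpret Zn: module K "ZM n"
    by (rule submodule.submodule_is_module[OF cocycles_submodule cpt_module])
  have "submodule (B n) K (ZM n)"
  proof (rule Zn.submoduleI)
    show "\<ominus>\<^bsub>ZM n\<^esub> f \<in> B n" if "f \<in> B n" for f
      using that Cn.submoduleE(3)[OF coboundaries_submodule that]
      by (simp add: cocycles_uminus subsetD[OF coboundaries_subset])
    show "\<zero>\<^bsub>ZM n\<^esub> \<in> B n"
      using subgroup.one_closed[OF submodule.axioms(1)[OF coboundaries_submodule]] by simp
  qed (use coboundaries_subset Cn.submoduleE(4,5)[OF coboundaries_submodule] in auto)
  then show ?thesis
    by (intro module_quotient.intro module_quotient_axioms.intro Zn.module_axioms)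
qed

lemma coh_class_eq: "cl n f = B n +>\<^bsub>ZM n\<^esub> f"
  by (simp add: coh_class_def a_r_coset_def r_coset_def)

lemma cocycle_signed: "f \<in> Z n \<Longrightarrow> signed (cpt P n) e f \<in> Z n"
  using module.submoduleE(3)[OF cpt_module cocycles_submodule, of f n] by (simp add: signed_def)

lemma cocycle_add: "f \<in> Z n \<Longrightarrow> g \<in> Z n \<Longrightarrow> f \<oplus>\<^bsub>cpt P n\<^esub> g \<in> Z n"
  using module.submoduleE(5)[OF cpt_module cocycles_submodule, of f n g] by simp

lemma cocycle_smult: "a \<in> carrier K \<Longrightarrow> f \<in> Z n \<Longrightarrow> a \<odot>\<^bsub>cpt P n\<^esub> f \<in> Z n"
  using module.submoduleE(4)[OF cpt_module cocycles_submodule, of a f n] by simp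

lemma cohomology_carrier: "carrier (H n) = cl n ` Z n"
  using module_quotient.carrier_quotient[OF quotient, of n]
  by (simp add: cohomology_def coh_class_eq[abs_def])

lemma cohomology_module: "module K (H n)"
  using module_quotient.quotient_is_module[OF quotient, of n] by (simp add: cohomology_def)

lemma cohomology_zero: "\<zero>\<^bsub>H n\<^esub> = cl n \<zero>\<^bsub>cpt P n\<^esub>"
  using module_quotient.zero_quotient[OF quotient, of n] by (simp add: cohomology_def coh_class_eq)

lemma cohomology_add: "f \<in> Z n \<Longrightarrow> g \<in> Z n \<Longrightarrow> cl n f \<oplus>\<^bsub>H n\<^esub> cl n g = cl n (f \<oplus>\<^bsub>cpt P n\<^esub> g)"
  using module_quotient.add_quotient[OF quotient, of f n g]
  by (simp add: cohomology_def coh_class_eq)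

lemma cohomology_smult:
  "a \<in> carrier K \<Longrightarrow> f \<in> Z n \<Longrightarrow> a \<odot>\<^bsub>H n\<^esub> cl n f = cl n (a \<odot>\<^bsub>cpt P n\<^esub> f)"
  using module_quotient.smult_quotient[OF quotient, of a f n]
  by (simp add: cohomology_def coh_class_eq)

lemma cohomology_signed:
  "f \<in> Z n \<Longrightarrow> signed (H n) e (cl n f) = cl n (signed (cpt P n) e f)"
  using module_quotient.uminus_quotient[OF quotient, of f n]
  by (simp add: cohomology_def coh_class_eq signed_def cocycles_uminus)

lemma cohomology_uminus: "f \<in> Z n \<Longrightarrow> \<ominus>\<^bsub>H n\<^esub> cl n f = cl n (\<ominus>\<^bsub>cpt P n\<^esub> f)"
  using cohomology_signed[of f n 1] by (simp add: signed_def)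

text \<open>
  The form in which the homotopy formulas are used: they exhibit the difference of two cocycles,
  seen in the ambient group, as the differential of some cochain.
\<close>

lemma coh_class_eqI:
  assumes "f \<in> Z n" "g \<in> Z n" "w \<in> \<epsilon> (n - 1) ` C (n - 1)"
    "\<epsilon> n f = \<epsilon> n g + ambient.d (n - 1) w"
  shows "cl n f = cl n g"
proof -
  interpret Cn: module K "cpt P n" by (fact cpt_module)
  have "f \<ominus>\<^bsub>cpt P n\<^esub> g \<in> B n"
    using assms by (intro coboundaryI[OF _ _ assms(3)])
      (auto simp: emb_minus cpt_group cocycle_carrier)
  then show ?thesis
    using module_quotient.coset_eq_iff[OF quotient, of f n g] assms
    by (simp add: coh_class_eq a_minus_def cocycles_uminus)
qed

lemma coh_class_add_coboundary:
  assumes "b \<in> B n" "f \<in> Z n"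
  shows "cl n (b \<oplus>\<^bsub>cpt P n\<^esub> f) = cl n f"
  using assms(1)
proof (rule coboundaryE)
  fix g assume "g \<in> C (n - 1)" "\<epsilon> n b = ambient.d (n - 1) (\<epsilon> (n - 1) g)"
  moreover have "b \<in> Z n" using assms coboundaries_subset by blast
  ultimately show ?thesis
    using assms by (intro coh_class_eqI[of _ _ _ "\<epsilon> (n - 1) g"])
      (auto simp: emb_add cpt_group cocycle_add cocycle_carrier)
qed

lemma coh_class_self:
  assumes "f \<in> Z n" shows "f \<in> cl n f"
proof -
  interpret q: module_quotient K "ZM n" "B n" by (fact quotient)
  show ?thesis using q.a_rcos_self[of f] assms by (simp add: coh_class_eq)
qed

lemma coh_class_memE:
  assumes "f' \<in> cl n f"
  obtains b where "b \<in> B n" "f' = b \<oplus>\<^bsub>cpt P n\<^esub> f"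
  using assms by (auto simp: coh_class_def a_r_coset_def r_coset_def)

text \<open>
  The common form of the two products on cohomology.
\<close>

definition induced ::
  "int \<Rightarrow> ('c \<Rightarrow> 'c \<Rightarrow> 'c) \<Rightarrow> 'c set \<Rightarrow> 'c set \<Rightarrow> 'c set" where
  "induced k \<phi> X Y = (\<Union>f\<in>X. \<Union>g\<in>Y. cl k (\<phi> f g))"

context
  fixes m n k \<phi>
  assumes bilinear: "bilinear_map K (cpt P m) (cpt P n) (cpt P k) \<phi>"
    and ZZ: "\<And>f g. f \<in> Z m \<Longrightarrow> g \<in> Z n \<Longrightarrow> \<phi> f g \<in> Z k"
    and BZ: "\<And>f g. f \<in> B m \<Longrightarrow> g \<in> Z n \<Longrightarrow> \<phi> f g \<in> B k"
    and ZB: "\<And>f g. f \<in> Z m \<Longrightarrow> g \<in> B n \<Longrightarrow> \<phi> f g \<in> B k"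
begin

text \<open>
  Other representatives are \<open>b + f\<close> and \<open>c + g\<close> with coboundaries \<open>b, c\<close>, and
  \<open>\<phi>(b + f, c + g) = \<phi>(b, c + g) + \<phi>(f, c) + \<phi>(f, g)\<close>, where the first two terms are
  coboundaries. So all classes in the union agree.
\<close>

lemma induced_class:
  assumes "f \<in> Z m" "g \<in> Z n"
  shows "induced k \<phi> (cl m f) (cl n g) = cl k (\<phi> f g)"
proof -
  have "cl k (\<phi> f' g') = cl k (\<phi> f g)" if f': "f' \<in> cl m f" and g': "g' \<in> cl n g" for f' g'
  proof -
    obtain b where b: "b \<in> B m" "f' = b \<oplus>\<^bsub>cpt P m\<^esub> f"
      using f' by (rule coh_class_memE)
    obtain c where c: "c \<in> B n" "g' = c \<oplus>\<^bsub>cpt P n\<^esub> g"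
      using g' by (rule coh_class_memE)
    have Z: "b \<in> Z m" "c \<in> Z n" using b c coboundaries_subset by blast+
    then have g'_Z: "g' \<in> Z n" using c assms by (simp add: cocycle_add)
    have "\<phi> f' g' = \<phi> b g' \<oplus>\<^bsub>cpt P k\<^esub> (\<phi> f c \<oplus>\<^bsub>cpt P k\<^esub> \<phi> f g)"
      using bilinear b c assms Z g'_Z unfolding bilinear_map_def by (simp add: cocycle_carrier)
    then show ?thesis
      using b c Z g'_Z assms
      by (simp add: coh_class_add_coboundary BZ ZB ZZ cocycle_add subsetD[OF coboundaries_subset])
  qed
  then have "induced k \<phi> (cl m f) (cl n g) = (\<Union>f'\<in>cl m f. \<Union>g'\<in>cl n g. cl k (\<phi> f g))"
    unfolding induced_def by (intro SUP_cong refl)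
  also have "\<dots> = cl k (\<phi> f g)"
    using coh_class_self[OF assms(1)] coh_class_self[OF assms(2)] by blast
  finally show ?thesis .
qed

lemma induced_bilinear: "bilinear_map K (H m) (H n) (H k) (induced k \<phi>)"
proof -
  have "\<phi> (x \<oplus>\<^bsub>cpt P m\<^esub> x') y = \<phi> x y \<oplus>\<^bsub>cpt P k\<^esub> \<phi> x' y"
    "\<phi> x (y \<oplus>\<^bsub>cpt P n\<^esub> y') = \<phi> x y \<oplus>\<^bsub>cpt P k\<^esub> \<phi> x y'"
    if "x \<in> Z m" "x' \<in> Z m" "y \<in> Z n" "y' \<in> Z n" for x x' y y'
    using bilinear that unfolding bilinear_map_def by (simp_all add: cocycle_carrier)
  note add = this
  have smult: "\<phi> (a \<odot>\<^bsub>cpt P m\<^esub> x) y = a \<odot>\<^bsub>cpt P k\<^esub> \<phi> x y"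
    "\<phi> x (a \<odot>\<^bsub>cpt P n\<^esub> y) = a \<odot>\<^bsub>cpt P k\<^esub> \<phi> x y"
    if "x \<in> Z m" "y \<in> Z n" "a \<in> carrier K" for x y a
    using bilinear that unfolding bilinear_map_def by (simp_all add: cocycle_carrier)
  show ?thesis
    unfolding bilinear_map_def cohomology_carrier ball_simps
    by (simp add: induced_class ZZ cohomology_add cohomology_smult
        cocycle_add cocycle_smult add smult)
qed

end

end

section \<open>The Gerstenhaber structure on cohomology\<close>

context multiplicative_pre_operad
begin

lemma cup_cocycle:
  assumes "f \<in> Z m" "g \<in> Z n" "k = m + n"
  shows "cup P \<mu> m n f g \<in> Z k"
  using assms ambient.d_cup[of m n "\<epsilon> m f" "\<epsilon> n g"]
  by (simp add: cocycle_iff emb_cup cup_closed mu_closed)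

lemma commutator_cocycle:
  assumes "f \<in> Z m" "g \<in> Z n" "k = m + n - 1"
  shows "commutator P m n f g \<in> Z k"
  using assms ambient.d_bracket[of m n "\<epsilon> m f" "\<epsilon> n g"]
  by (simp add: cocycle_iff emb_commutator commutator_closed ambient.bracket_zero)

text \<open>
  By \<open>d_cup\<close>, if \<open>f = \<delta>a\<close> and \<open>\<delta>g = 0\<close>, then \<open>f \<smile> g\<close> is up to sign the coboundary of
  \<open>a \<smile> g\<close>. The next three lemmas apply \<open>d_cup\<close> and \<open>d_bracket\<close> in the same way.
\<close>

lemma cup_coboundary_left:
  assumes "f \<in> B m" "g \<in> Z n"
  shows "cup P \<mu> m n f g \<in> B (m + n)"
  using assms(1)
proof (rule coboundaryE)
  fix a assume a: "a \<in> C (m - 1)" "\<epsilon> m f = ambient.d (m - 1) (\<epsilon> (m - 1) a)"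
  let ?w = "signed (cpt P (m + n - 1)) n (cup P \<mu> (m - 1) n a g)"
  have g: "g \<in> C n" "ambient.d n (\<epsilon> n g) = 0" using assms by (simp_all add: cocycle_iff)
  have f: "f \<in> C m" using assms coboundaries_subset cocycle_carrier by blast
  have w: "cup P \<mu> (m - 1) n a g \<in> C (m + n - 1)"
    using a g by (intro cup_closed mu_closed) auto
  have idx: "m - 1 + n = m + n - 1" by simp
  have "\<epsilon> (m + n) (cup P \<mu> m n f g) = ambient.d (m + n - 1) (\<epsilon> (m + n - 1) ?w)"
    using ambient.d_cup[of "m - 1" n "\<epsilon> (m - 1) a" "\<epsilon> n g", unfolded idx] a f g w
    by (simp add: emb_cup emb_signed cpt_group ambient.d_sg) (simp add: sg_def)
  then show ?thesis
    using a f g w by (intro coboundaryI[OF _ _ imageI[of ?w]] cup_closed mu_closed signed_closed cpt_group) auto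
qed

lemma cup_coboundary_right:
  assumes "f \<in> Z m" "g \<in> B n"
  shows "cup P \<mu> m n f g \<in> B (m + n)"
  using assms(2)
proof (rule coboundaryE)
  fix b assume b: "b \<in> C (n - 1)" "\<epsilon> n g = ambient.d (n - 1) (\<epsilon> (n - 1) b)"
  let ?w = "cup P \<mu> m (n - 1) f b"
  have f: "f \<in> C m" "ambient.d m (\<epsilon> m f) = 0" using assms by (simp_all add: cocycle_iff)
  have g: "g \<in> C n" using assms coboundaries_subset cocycle_carrier by blast
  have w: "?w \<in> C (m + n - 1)"
    using b f by (intro cup_closed mu_closed) auto
  have "\<epsilon> (m + n) (cup P \<mu> m n f g) = ambient.d (m + n - 1) (\<epsilon> (m + n - 1) ?w)"
    using ambient.d_cup[of m "n - 1" "\<epsilon> m f" "\<epsilon> (n - 1) b"] b f g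
    by (simp add: emb_cup add_diff_eq)
  then show ?thesis
    using b f g w by (intro coboundaryI[OF _ _ imageI[of ?w]] cup_closed mu_closed) auto
qed

lemma commutator_coboundary_left:
  assumes "f \<in> B m" "g \<in> Z n"
  shows "commutator P m n f g \<in> B (m + n - 1)"
  using assms(1)
proof (rule coboundaryE)
  fix a assume a: "a \<in> C (m - 1)" "\<epsilon> m f = ambient.d (m - 1) (\<epsilon> (m - 1) a)"
  let ?w = "signed (cpt P (m + n - 1 - 1)) (n - 1) (commutator P (m - 1) n a g)"
  have g: "g \<in> C n" "ambient.d n (\<epsilon> n g) = 0" using assms by (simp_all add: cocycle_iff)
  have f: "f \<in> C m" using assms coboundaries_subset cocycle_carrier by blast
  have w: "commutator P (m - 1) n a g \<in> C (m + n - 1 - 1)"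
    using a g by (intro commutator_closed) auto
  have idx: "m - 1 + n - 1 = m + n - 1 - 1" by simp
  have "\<epsilon> (m + n - 1) (commutator P m n f g) = ambient.d (m + n - 1 - 1) (\<epsilon> (m + n - 1 - 1) ?w)"
    using ambient.d_bracket[of "m - 1" n "\<epsilon> (m - 1) a" "\<epsilon> n g", unfolded idx] a f g w
    by (simp add: emb_commutator emb_signed cpt_group ambient.d_sg ambient.bracket_zero)
      (simp add: sg_def)
  then show ?thesis
    using a f g w by (intro coboundaryI[OF _ _ imageI[of ?w]] commutator_closed signed_closed cpt_group) auto
qed

lemma commutator_coboundary_right:
  assumes "f \<in> Z m" "g \<in> B n"
  shows "commutator P m n f g \<in> B (m + n - 1)"
  using assms(2)
proof (rule coboundaryE)
  fix b assume b: "b \<in> C (n - 1)" "\<epsilon> n g = ambient.d (n - 1) (\<epsilon> (n - 1) b)"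
  let ?w = "commutator P m (n - 1) f b"
  have f: "f \<in> C m" "ambient.d m (\<epsilon> m f) = 0" using assms by (simp_all add: cocycle_iff)
  have g: "g \<in> C n" using assms coboundaries_subset cocycle_carrier by blast
  have w: "?w \<in> C (m + n - 1 - 1)"
    using b f by (intro commutator_closed) auto
  have idx: "m + (n - 1) - 1 = m + n - 1 - 1" by simp
  have "\<epsilon> (m + n - 1) (commutator P m n f g) = ambient.d (m + n - 1 - 1) (\<epsilon> (m + n - 1 - 1) ?w)"
    using ambient.d_bracket[of m "n - 1" "\<epsilon> m f" "\<epsilon> (n - 1) b", unfolded idx] b f g
    by (simp add: emb_commutator ambient.bracket_zero)
  then show ?thesis
    using b f g w by (intro coboundaryI[OF _ _ imageI[of ?w]] commutator_closed) auto
qed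

lemma coh_cup_induced: "coh_cup P \<mu> m n = induced (m + n) (cup P \<mu> m n)"
  by (intro ext) (simp add: coh_cup_def induced_def)

lemma coh_commutator_induced: "coh_commutator P \<mu> m n = induced (m + n - 1) (commutator P m n)"
  by (intro ext) (simp add: coh_commutator_def induced_def)

lemma coh_cup_class:
  assumes "f \<in> Z m" "g \<in> Z n" "k = m + n"
  shows "coh_cup P \<mu> m n (cl m f) (cl n g) = cl k (cup P \<mu> m n f g)"
  unfolding coh_cup_induced assms(3) using assms(1,2)
  by (intro induced_class cup_bilinear mu_closed cup_cocycle cup_coboundary_left
      cup_coboundary_right) auto

lemma coh_commutator_class:
  assumes "f \<in> Z m" "g \<in> Z n" "k = m + n - 1"
  shows "coh_commutator P \<mu> m n (cl m f) (cl n g) = cl k (commutator P m n f g)"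
  unfolding coh_commutator_induced assms(3) using assms(1,2)
  by (intro induced_class commutator_bilinear commutator_cocycle commutator_coboundary_left
      commutator_coboundary_right) auto

lemma coh_cup_bilinear: "bilinear_map K (H m) (H n) (H (m + n)) (coh_cup P \<mu> m n)"
  unfolding coh_cup_induced
  by (intro induced_bilinear cup_bilinear mu_closed cup_cocycle cup_coboundary_left
      cup_coboundary_right) auto

lemma coh_commutator_bilinear:
  "bilinear_map K (H m) (H n) (H (m + n - 1)) (coh_commutator P \<mu> m n)"
  unfolding coh_commutator_induced
  by (intro induced_bilinear commutator_bilinear commutator_cocycle commutator_coboundary_left
      commutator_coboundary_right) auto

lemma coh_class_eq_emb:
  assumes "f \<in> C n" "g \<in> C n" "\<epsilon> n f = \<epsilon> n g"
  shows "cl n f = cl n g"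
  using assms by (simp add: emb_inject cpt_group)

lemma sg_in_image: "w \<in> \<epsilon> n ` C n \<Longrightarrow> sg e w \<in> \<epsilon> n ` C n"
  by (auto simp: emb_signed[symmetric] cpt_group intro!: imageI signed_closed)

text \<open>
  Representatives are chosen and the identities of the preceding sections applied to them.
  Graded commutativity uses \<open>\<delta>(f \<bullet> g)\<close> and the Leibniz rule \<open>\<delta>(h\<langle>f, g\<rangle>)\<close>; the other axioms hold
  for the representatives themselves.
\<close>

theorem gerstenhaber: "gerstenhaber_algebra K H (coh_cup P \<mu>) (coh_commutator P \<mu>)"
proof (rule gerstenhaber_algebra.intro)
  show "module K (H n)" for n
    by (fact cohomology_module)
  show "carrier (H n) = {\<zero>\<^bsub>H n\<^esub>}" if "n < 0" for n
  proof -
    have "\<zero>\<^bsub>cpt P n\<^esub> \<in> Z n"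
      using subgroup.one_closed[OF submodule.axioms(1)[OF cocycles_submodule]] by simp
    then have "Z n = {\<zero>\<^bsub>cpt P n\<^esub>}"
      using cpt_negative[OF that] cocycle_carrier by auto
    then show ?thesis by (simp add: cohomology_carrier cohomology_zero)
  qed
  show "bilinear_map K (H m) (H n) (H (m + n)) (coh_cup P \<mu> m n)" for m n
    by (fact coh_cup_bilinear)
  show "bilinear_map K (H m) (H n) (H (m + n - 1)) (coh_commutator P \<mu> m n)" for m n
    by (fact coh_commutator_bilinear)
  show "has_reduced_degree H (coh_commutator P \<mu>) 0"
    unfolding has_reduced_degree_def
  proof (intro allI impI ballI)
    fix m n k :: int and f g
    assume "k - 1 = m - 1 + (n - 1) + 0" and fg: "f \<in> carrier (H m)" "g \<in> carrier (H n)"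
    then have k: "k = m + n - 1" by simp
    show "coh_commutator P \<mu> m n f g \<in> carrier (H k)"
      unfolding k by (rule bilinear_closed[OF coh_commutator_bilinear fg])
  qed
  show "has_reduced_degree H (coh_cup P \<mu>) 1"
    unfolding has_reduced_degree_def
  proof (intro allI impI ballI)
    fix m n k :: int and f g
    assume "k - 1 = m - 1 + (n - 1) + 1" and fg: "f \<in> carrier (H m)" "g \<in> carrier (H n)"
    then have k: "k = m + n" by simp
    show "coh_cup P \<mu> m n f g \<in> carrier (H k)"
      unfolding k by (rule bilinear_closed[OF coh_cup_bilinear fg])
  qed
next
  fix m n F G
  assume "F \<in> carrier (H m)" "G \<in> carrier (H n)"
  then obtain f g where f: "f \<in> Z m" "F = cl m f" and g: "g \<in> Z n" "G = cl n g"
    by (auto simp: cohomology_carrier)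
  let ?k = "m + n - 1"
  have Z: "commutator P m n f g \<in> Z ?k" "commutator P n m g f \<in> Z ?k"
    using f g by (auto intro: commutator_cocycle)
  have "coh_commutator P \<mu> m n F G = cl ?k (commutator P m n f g)"
    using f g by (simp add: coh_commutator_class)
  also have "\<dots> = cl ?k (\<ominus>\<^bsub>cpt P ?k\<^esub> signed (cpt P ?k) ((m - 1) * (n - 1)) (commutator P n m g f))"
    using ambient.bracket_antisym[of m n "\<epsilon> m f" "\<epsilon> n g"] Z f g
    by (intro coh_class_eq_emb)
      (auto simp: emb_uminus emb_signed emb_commutator cpt_group signed_closed cocycle_carrier
        abelian_group.a_inv_closed)
  also have "\<dots> = \<ominus>\<^bsub>H ?k\<^esub> signed (H ?k) ((m - 1) * (n - 1)) (coh_commutator P \<mu> n m G F)"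
    using f g Z by (simp add: coh_commutator_class[where k = ?k] cohomology_signed
        cohomology_uminus cocycle_signed)
  finally show "coh_commutator P \<mu> m n F G =
      \<ominus>\<^bsub>H ?k\<^esub> signed (H ?k) ((m - 1) * (n - 1)) (coh_commutator P \<mu> n m G F)" .
next
  fix m n F G
  assume "F \<in> carrier (H m)" "G \<in> carrier (H n)"
  then obtain f g where f: "f \<in> Z m" "F = cl m f" and g: "g \<in> Z n" "G = cl n g"
    by (auto simp: cohomology_carrier)
  let ?k = "m + n"
  let ?w = "sg (n - 1) (\<epsilon> (?k - 1) (total_comp P m n f g))"
  have Z: "cup P \<mu> m n f g \<in> Z ?k" "cup P \<mu> n m g f \<in> Z ?k"
    using f g by (auto intro: cup_cocycle)
  have "ambient.d (?k - 1) ?w =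
      ambient.cup m n (\<epsilon> m f) (\<epsilon> n g) - sg (m * n) (ambient.cup n m (\<epsilon> n g) (\<epsilon> m f))"
    using ambient.d_tot[of m n "\<epsilon> m f" "\<epsilon> n g"] f g
    by (simp add: emb_total_comp cocycle_carrier d_cocycle ambient.d_sg)
      (simp add: sg_def)
  then have "cl ?k (cup P \<mu> m n f g) = cl ?k (signed (cpt P ?k) (m * n) (cup P \<mu> n m g f))"
    using f g Z
    by (intro coh_class_eqI[of _ _ _ ?w] cocycle_signed sg_in_image imageI total_comp_closed)
      (auto simp: emb_cup emb_signed cpt_group cocycle_carrier)
  then show "coh_cup P \<mu> m n F G = signed (H ?k) (m * n) (coh_cup P \<mu> n m G F)"
    using f g Z by (simp add: coh_cup_class[where k = ?k] cohomology_signed)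
next
  fix m n p F G E
  assume "F \<in> carrier (H m)" "G \<in> carrier (H n)" "E \<in> carrier (H p)"
  then obtain f g h where f: "f \<in> Z m" "F = cl m f" and g: "g \<in> Z n" "G = cl n g"
    and h: "h \<in> Z p" "E = cl p h"
    by (auto simp: cohomology_carrier)
  note carriers = f(1)[THEN cocycle_carrier] g(1)[THEN cocycle_carrier] h(1)[THEN cocycle_carrier]
  let ?br = "commutator P" and ?j = "m + n + p - 2"
  have Z1: "?br m n f g \<in> Z (m + n - 1)" "?br n p g h \<in> Z (n + p - 1)" "?br p m h f \<in> Z (p + m - 1)"
    using f g h by (simp_all add: commutator_cocycle)
  have jacobi_Z: "?br (m + n - 1) p (?br m n f g) h \<in> Z ?j"
    "?br (n + p - 1) m (?br n p g h) f \<in> Z ?j" "?br (p + m - 1) n (?br p m h f) g \<in> Z ?j"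
    using f g h Z1 by (simp_all add: commutator_cocycle)
  have "\<epsilon> ?j (signed (cpt P ?j) ((m - 1) * (p - 1)) (?br (m + n - 1) p (?br m n f g) h)
            \<oplus>\<^bsub>cpt P ?j\<^esub> signed (cpt P ?j) ((n - 1) * (m - 1)) (?br (n + p - 1) m (?br n p g h) f)
            \<oplus>\<^bsub>cpt P ?j\<^esub> signed (cpt P ?j) ((p - 1) * (n - 1)) (?br (p + m - 1) n (?br p m h f) g))
      = \<epsilon> ?j \<zero>\<^bsub>cpt P ?j\<^esub>"
    using ambient.bracket_jacobi[of m p n "\<epsilon> m f" "\<epsilon> n g" "\<epsilon> p h"] Z1 jacobi_Z carriers
    by (simp add: emb_add emb_signed emb_commutator emb_zero cpt_group signed_closed
        cocycle_carrier abelian_groupE(1))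
  then show "signed (H ?j) ((m - 1) * (p - 1))
        (coh_commutator P \<mu> (m + n - 1) p (coh_commutator P \<mu> m n F G) E) \<oplus>\<^bsub>H ?j\<^esub>
      signed (H ?j) ((n - 1) * (m - 1))
        (coh_commutator P \<mu> (n + p - 1) m (coh_commutator P \<mu> n p G E) F) \<oplus>\<^bsub>H ?j\<^esub>
      signed (H ?j) ((p - 1) * (n - 1))
        (coh_commutator P \<mu> (p + m - 1) n (coh_commutator P \<mu> p m E F) G) = \<zero>\<^bsub>H ?j\<^esub>"
    using f g h Z1 jacobi_Z
    by (simp add: coh_commutator_class[of f m g n "m + n - 1"]
        coh_commutator_class[of g n h p "n + p - 1"] coh_commutator_class[of h p f m "p + m - 1"]
        coh_commutator_class[of _ "m + n - 1" h p ?j] coh_commutator_class[of _ "n + p - 1" f m ?j]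
        coh_commutator_class[of _ "p + m - 1" g n ?j] cohomology_signed
        cohomology_add cohomology_zero cocycle_signed cocycle_add emb_inject cpt_group
        cocycle_carrier abelian_groupE(2))
next
  fix m n p F G E
  assume "F \<in> carrier (H m)" "G \<in> carrier (H n)" "E \<in> carrier (H p)"
  then obtain f g h where f: "f \<in> Z m" "F = cl m f" and g: "g \<in> Z n" "G = cl n g"
    and h: "h \<in> Z p" "E = cl p h"
    by (auto simp: cohomology_carrier)
  note carriers = f(1)[THEN cocycle_carrier] g(1)[THEN cocycle_carrier] h(1)[THEN cocycle_carrier]
  let ?cp = "cup P \<mu>" and ?k = "m + n + p"
  have Z1: "?cp m n f g \<in> Z (m + n)" "?cp n p g h \<in> Z (n + p)"
    using f g h by (simp_all add: cup_cocycle)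
  have assoc_C: "?cp (m + n) p (?cp m n f g) h \<in> C ?k" "?cp m (n + p) f (?cp n p g h) \<in> C ?k"
    using f g h Z1 by (simp_all add: cup_closed mu_closed cocycle_carrier)
  have "cl ?k (?cp (m + n) p (?cp m n f g) h) = cl ?k (?cp m (n + p) f (?cp n p g h))"
    using ambient.cup_assoc[of m n p "\<epsilon> m f" "\<epsilon> n g" "\<epsilon> p h"] Z1 assoc_C carriers
    by (intro coh_class_eq_emb) (auto simp: emb_cup cocycle_carrier)
  then show "coh_cup P \<mu> (m + n) p (coh_cup P \<mu> m n F G) E =
      coh_cup P \<mu> m (n + p) F (coh_cup P \<mu> n p G E)"
    using f g h Z1 by (simp add: coh_cup_class[of f m g n "m + n"] coh_cup_class[of g n h p "n + p"]
        coh_cup_class[of _ "m + n" h p ?k] coh_cup_class[of f m _ "n + p" ?k])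
next
  fix m n p F G E
  assume "F \<in> carrier (H m)" "G \<in> carrier (H n)" "E \<in> carrier (H p)"
  then obtain f g h where f: "f \<in> Z m" "F = cl m f" and g: "g \<in> Z n" "G = cl n g"
    and h: "h \<in> Z p" "E = cl p h"
    by (auto simp: cohomology_carrier)
  note carriers = f(1)[THEN cocycle_carrier] g(1)[THEN cocycle_carrier] h(1)[THEN cocycle_carrier]
  let ?br = "commutator P" and ?cp = "cup P \<mu>" and ?l = "m + n + p - 1"
  have Z1: "?br p m h f \<in> Z (p + m - 1)" "?br p n h g \<in> Z (p + n - 1)" "?cp m n f g \<in> Z (m + n)"
    using f g h by (simp_all add: commutator_cocycle cup_cocycle)
  \<comment> \<open>The sign is the one in front of the Leibniz defect in \<open>d_brace\<close>.\<close>
  let ?w = "sg (m * n + m + 1) (ambient.brace p m n (\<epsilon> p h) (\<epsilon> m f) (\<epsilon> n g))"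
  have leibniz_Z: "?br p (m + n) h (?cp m n f g) \<in> Z ?l" "?cp (p + m - 1) n (?br p m h f) g \<in> Z ?l"
    "?cp m (p + n - 1) f (?br p n h g) \<in> Z ?l"
    using f g h Z1 by (auto intro!: commutator_cocycle cup_cocycle)
  have idx: "p + m + n - 2 = ?l - 1" by simp
  have w: "?w \<in> \<epsilon> (?l - 1) ` C (?l - 1)"
    by (intro sg_in_image brace_in_image) simp
  have "ambient.d (?l - 1) ?w =
      ambient.bracket p (m + n) (\<epsilon> p h) (ambient.cup m n (\<epsilon> m f) (\<epsilon> n g))
       - ambient.cup (p + m - 1) n (ambient.bracket p m (\<epsilon> p h) (\<epsilon> m f)) (\<epsilon> n g)
       - sg ((p - 1) * m) (ambient.cup m (p + n - 1) (\<epsilon> m f) (ambient.bracket p n (\<epsilon> p h) (\<epsilon> n g)))"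
    using f g h ambient.d_brace[of p m n "\<epsilon> p h" "\<epsilon> m f" "\<epsilon> n g", unfolded idx]
    by (simp only: d_cocycle ambient.d_sg ambient.brace_zero sg_simps(1) add_0_left)
      (simp add: sg_def)
  then have "cl ?l (?br p (m + n) h (?cp m n f g)) =
      cl ?l (?cp (p + m - 1) n (?br p m h f) g \<oplus>\<^bsub>cpt P ?l\<^esub>
        signed (cpt P ?l) ((p - 1) * m) (?cp m (p + n - 1) f (?br p n h g)))"
    using Z1 leibniz_Z carriers
    by (intro coh_class_eqI[OF _ _ w] cocycle_add cocycle_signed)
      (simp_all add: emb_add emb_signed emb_commutator emb_cup cpt_group signed_closed
        cocycle_carrier)
  then show "coh_commutator P \<mu> p (m + n) E (coh_cup P \<mu> m n F G) =
      coh_cup P \<mu> (p + m - 1) n (coh_commutator P \<mu> p m E F) G \<oplus>\<^bsub>H ?l\<^esub>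
      signed (H ?l) ((p - 1) * m) (coh_cup P \<mu> m (p + n - 1) F (coh_commutator P \<mu> p n E G))"
    using f g h Z1 leibniz_Z
    by (simp add: coh_cup_class[of f m g n "m + n"]
        coh_commutator_class[of h p f m "p + m - 1"] coh_commutator_class[of h p g n "p + n - 1"]
        coh_commutator_class[of h p _ "m + n" ?l] coh_cup_class[of _ "p + m - 1" g n ?l]
        coh_cup_class[of f m _ "p + n - 1" ?l] cohomology_signed
        cohomology_add cocycle_signed cocycle_add)
qed

end

theorem mainTheorem1:
  fixes K :: "('k, 'r) ring_scheme" and P :: "('k, 'c) pre_operad" and \<mu> :: 'c
  assumes "cring K"
    and "linear_pre_operad K P"
    and "\<mu> \<in> carrier (cpt P 2)"
    and "total_comp P 2 2 \<mu> \<mu> = \<zero>\<^bsub>cpt P 3\<^esub>"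
  shows "(\<forall>n. \<forall>f\<in>carrier (cpt P n). delta P \<mu> n f \<in> carrier (cpt P (n + 1)) \<and>
              delta P \<mu> (n + 1) (delta P \<mu> n f) = \<zero>\<^bsub>cpt P (n + 2)\<^esub>) \<and>
         (\<forall>n. submodule (cocycles P \<mu> n) K (cpt P n) \<and>
              submodule (coboundaries P \<mu> n) K (cpt P n) \<and>
              coboundaries P \<mu> n \<subseteq> cocycles P \<mu> n) \<and>
         coboundaries P \<mu> 0 = {\<zero>\<^bsub>cpt P 0\<^esub>} \<and>
         (\<forall>m n. \<forall>f\<in>cocycles P \<mu> m. \<forall>g\<in>cocycles P \<mu> n.
              cup P \<mu> m n f g \<in> cocycles P \<mu> (m + n) \<and>
              coh_cup P \<mu> m n (coh_class P \<mu> m f) (coh_class P \<mu> n g) =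
                coh_class P \<mu> (m + n) (cup P \<mu> m n f g)) \<and>
         (\<forall>m n. \<forall>f\<in>cocycles P \<mu> m. \<forall>g\<in>cocycles P \<mu> n.
              commutator P m n f g \<in> cocycles P \<mu> (m + n - 1) \<and>
              coh_commutator P \<mu> m n (coh_class P \<mu> m f) (coh_class P \<mu> n g) =
                coh_class P \<mu> (m + n - 1) (commutator P m n f g)) \<and>
         gerstenhaber_algebra K (cohomology P \<mu>) (coh_cup P \<mu>) (coh_commutator P \<mu>)"
proof -
  interpret multiplicative_pre_operad K P \<mu>
    using assms(2-4)
    by (intro multiplicative_pre_operad.intro multiplicative_pre_operad_axioms.intro)
  \<comment> \<open>Every coboundary in degree 0 is the image of the only element of degree -1.\<close>
  have degree_zero: "coboundaries P \<mu> 0 = {\<zero>\<^bsub>cpt P 0\<^esub>}"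
  proof -
    have "coboundaries P \<mu> 0 = {delta P \<mu> (- 1) \<zero>\<^bsub>cpt P (- 1)\<^esub>}"
      using cpt_negative[of "- 1"] by (simp add: coboundaries_def)
    moreover have "\<zero>\<^bsub>cpt P 0\<^esub> \<in> coboundaries P \<mu> 0"
      using subgroup.one_closed[OF submodule.axioms(1)[OF coboundaries_submodule]] by simp
    ultimately show ?thesis by simp
  qed
  show ?thesis
    using delta_closed delta_delta cocycles_submodule coboundaries_submodule coboundaries_subset
      degree_zero cup_cocycle coh_cup_class commutator_cocycle coh_commutator_class gerstenhaber
    by (intro conjI allI ballI) simp_all
qed

end
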